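(* Let the discrete mean field game data satisfy Assumptions 1, 2, 3 of the context. Let $(m^k,w^k)_{k\ge1}$ be generated by the generalized Frank-Wolfe algorithm described in the context, and let $(\bar m,\bar w)=(\bar m,\bar m\bar v)$, where $(\bar u,\bar v,\bar m)$ is the unique solution of the discrete mean field game. 1. (Sublinear rate) If $\lambda_k=2/(k+2)$ for all $k\ge1$, then $$\tilde J(m^k,w^k)-\tilde J(\bar m,\bar w)\le\frac{8D_1}{k},\qquad\forall k\ge1.$$ 2. (Linear rate) If, for all $k\ge1$, $$\lambda_k=\min\left\{\frac{\tilde J_{m^k}(m^k,w^k)-\tilde J_{m^k}(\bar m^k,\bar w^k)}{L_f|S|^{1/2}\|m^k-\bar m^k\|_{\infty,2}^2},\,1\right\}$$ (with $\lambda_k=1$ if $m^k=\bar m^k$), then $$\tilde J(m^k,w^k)-\tilde J(\bar m,\bar w)\le4D_1c^k,\qquad\forall k\ge1.$$ Here, with $C_1,C_2,C_3$ defined in the context, $$D_1=C_1L_f|S|^{1/2},\qquad c=\max\Big\{1-\frac{\alpha}{4C_2C_3L_f|S|^{1/2}},\ \frac12\Big\}.$$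
   Context: **Notation.** $T\in\mathbb{N}_+$, $\Delta t=1/T$, $\mathcal T=\{0,\dots,T-1\}$, $\tilde{\mathcal T}=\{0,\dots,T\}$, $S\subset\mathbb{R}^d$ finite. $\mathbb{R}(X)$, $\mathbb{R}^d(X)$: functions from $X$ to $\mathbb{R}$, $\mathbb{R}^d$. $\mathcal P(S)=\{m\in\mathbb{R}(S):m\ge0,\sum_Sm=1\}$; $\mathcal P(\tilde{\mathcal T},S)$: functions $m$ on $\tilde{\mathcal T}\times S$ with $m(t,\cdot)\in\mathcal P(S)$ for all $t$. $\|\mu\|_{\infty,p}=\max_t\|\mu(t,\cdot)\|_p$ with $\|\nu\|_p=(\sum_{x\in S}\|\nu(x)\|^p)^{1/p}$, $\|\nu\|_\infty=\max_S\|\nu\|$. **Data.** $\ell:\mathcal T\times S\times\mathbb{R}^d\to\mathbb{R}\cup\{\infty\}$, $f:\mathcal T\times S\times\mathbb{R}(S)\to\mathbb{R}$, $m_0\in\mathcal P(S)$, $g\in\mathbb{R}(S)$, $\pi_0\in\mathbb{R}(\mathcal T\times S^2)$, $\pi_1\in\mathbb{R}^d(\mathcal T\times S^2)$, and $\pi(t,x,y,\omega)=\pi_0(t,x,y)+\Delta t\langle\pi_1(t,x,y),\omega\rangle$. **Assumption 1.** (1) Each $\ell(t,x,\cdot)$ is lower semi-continuous with non-empty domain, and there is $D>0$ with $\ell(t,x,v)=+\infty$ whenever $\|v\|>D$. (2) There is $L_f>0$ with $|f(t,x,m_1)-f(t,x,m_2)|\le L_f\|m_1-m_2\|_2$ for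 all $(t,x)$, $m_1,m_2\in\mathcal P(S)$. (3) There is $\alpha>0$ such that each $\ell(t,x,\cdot)$ is $\alpha$-strongly convex, i.e. $\ell(t,x,v_2)\ge\ell(t,x,v_1)+\langle p,v_2-v_1\rangle+\frac\alpha2\|v_2-v_1\|^2$ for all $v_1,v_2\in\mathbb{R}^d$ and all subgradients $p$ of $\ell(t,x,\cdot)$ at $v_1$. (4) $\sum_{x\in S}(f(t,x,m_1)-f(t,x,m_2))(m_1(x)-m_2(x))\ge0$ for all $t\in\mathcal T$, $m_1,m_2\in\mathcal P(S)$. **Assumption 2.** For all $(t,x,y)$: $\pi_0(t,x,\cdot)\in\mathcal P(S)$, $\sum_{z\in S}\pi_1(t,x,z)=0$, $\pi_0(t,x,y)\ge\Delta tD\|\pi_1(t,x,y)\|$. **Assumption 3.** There is $F:\mathcal T\times\mathcal P(S)\to\mathbb{R}$ with $F(t,m_2)-F(t,m_1)=\int_0^1\sum_{x\in S}f(t,x,m_1+s(m_2-m_1))(m_2(x)-m_1(x))ds$ for all $t\in\mathcal T$, $m_1,m_2\in\mathcal P(S)$. **Mappings.** $u=\mathbf{HJB}(m)$: $u(T,\cdot)=g$, $u(t,x)=\inf_{\omega\in\mathbb{R}^d}\big[(\ell(t,x,\omega)+f(t,x,m(t)))\Delta t+\sum_{y}\pi(t,x,y,\omega)u(t+1,y)\big]$. $v=\mathbf V(u)$: $v(t,x)=\mathrm{argmin}_{\omega\in\mathbb{R}^d}\,\ell(t,x,\omega)\Delta t+\sum_y\pi(t,x,y,\omega)u(t+1,y)$.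 $m=\mathbf{FP}(v)$: $m(0)=m_0$, $m(t+1,y)=\sum_x\pi(t,x,y,v(t,x))m(t,x)$. The discrete mean field game is the system $u=\mathbf{HJB}(m)$, $v=\mathbf V(u)$, $m=\mathbf{FP}(v)$, which has a unique solution $(\bar u,\bar v,\bar m)$ with $\bar m\in\mathcal P(\tilde{\mathcal T},S)$. **Costs and admissible sets.** $\mathcal A=\{(m,v)\in\mathcal P(\tilde{\mathcal T},S)\times\mathbb{R}^d(\mathcal T\times S):m=\mathbf{FP}(v),\|v\|_{\infty,\infty}\le D\}$, $\tilde{\mathcal A}=\{(m,mv):(m,v)\in\mathcal A\}$ (pointwise product on $\mathcal T\times S$). $\tilde\ell[m,w](t,x)=\ell(t,x,w(t,x)/m(t,x))m(t,x)$ if $m(t,x)\ne0$, $0$ if $m(t,x)=w(t,x)=0$, $+\infty$ otherwise. $$\tilde J(m,w)=\Delta t\sum_{t\in\mathcal T}\sum_{x\in S}\tilde\ell[m,w](t,x)+\Delta t\sum_{t\in\mathcal T}F(t,m(t))+\sum_{x\in S}g(x)m(T,x),$$ $$\tilde J_{m'}(m,w)=\Delta t\sum_{t\in\mathcal T}\sum_{x\in S}\big(\tilde\ell[m,w](t,x)+f(t,x,m'(t))m(t,x)\big)+\sum_{x\in S}g(x)m(T,x).$$ **Constants.** $C_1=\sup_{\|v\|_{\infty,\infty}\le D}\|\mathbf{FP}(v)\|_{\infty,2}^2$, $C_2=\sup_{m\in\mathcal P(\tilde{\mathcal T},S)}\|\mathbf{FP}\circ\mathbf V\circ\mathbf{HJB}(m)\|_{\infty,\infty}$,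 and $C_3>0$ is a constant such that $\|m_1-m_2\|_{\infty,2}^2\le C_3\Delta t\sum_{t\in\mathcal T}\sum_{x\in S}\|(v_1-v_2)(t,x)m_1(t,x)\|^2$ for all $(m_1,v_1),(m_2,v_2)\in\mathcal A$ (such a constant exists). **Algorithm.** $\mathbf{BR}(m')=(\tilde m,\tilde m\tilde v)$ with $\tilde v=\mathbf V(\mathbf{HJB}(m'))$, $\tilde m=\mathbf{FP}(\tilde v)$. Given $(m^0,w^0)\in\tilde{\mathcal A}$, set $(m^1,w^1)=\mathbf{BR}(m^0)$; for $k\ge1$ set $(\bar m^k,\bar w^k)=\mathbf{BR}(m^k)$ and $(m^{k+1},w^{k+1})=(1-\lambda_k)(m^k,w^k)+\lambda_k(\bar m^k,\bar w^k)$ with $\lambda_k\in[0,1]$. *)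

theory Defs
  imports "HOL-Analysis.Analysis"
begin

text \<open>
  Encoding of functions on finite domains. A function on \<open>S\<close>, respectively on \<open>I \<times> S\<close> with
  \<open>I\<close> a set of times, is represented by its extension by zero to the whole type. This
  convention is compatible with the linear structure, and it makes equality of functions on the
  domain the same as equality in HOL; in particular a value \<open>f t x \<mu>\<close> depends only on the
  restriction of \<open>\<mu>\<close> to \<open>S\<close>.
\<close>

definition funs_on :: "nat set \<Rightarrow> 'a set \<Rightarrow> (nat \<Rightarrow> 'a \<Rightarrow> 'b::zero) set" where
  "funs_on I S = {h. \<forall>t x. \<not> (t \<in> I \<and> x \<in> S) \<longrightarrow> h t x = 0}"

definition prob_funs :: "'a set \<Rightarrow> ('a \<Rightarrow> real) set" where
  "prob_funs S = {\<mu>. (\<forall>x. x \<notin> S \<longrightarrow> \<mu> x = 0) \<and> (\<forall>x\<in>S. 0 \<le> \<mu> x) \<and> (\<Sum>x\<in>S. \<mu> x) = 1}"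

definition norm_inf_2 :: "nat set \<Rightarrow> 'a set \<Rightarrow> (nat \<Rightarrow> 'a \<Rightarrow> 'b::real_normed_vector) \<Rightarrow> real" where
  "norm_inf_2 I S \<mu> = (MAX t\<in>I. L2_set (\<lambda>x. norm (\<mu> t x)) S)"

definition norm_inf_inf :: "nat set \<Rightarrow> 'a set \<Rightarrow> (nat \<Rightarrow> 'a \<Rightarrow> 'b::real_normed_vector) \<Rightarrow> real" where
  "norm_inf_inf I S \<mu> = (MAX t\<in>I. MAX x\<in>S. norm (\<mu> t x))"

definition lower_semicont :: "('a::topological_space \<Rightarrow> ereal) \<Rightarrow> bool" where
  "lower_semicont h \<longleftrightarrow> (\<forall>v. h v \<le> Liminf (at v) h)"

definition is_subgradient :: "('a::real_inner \<Rightarrow> ereal) \<Rightarrow> 'a \<Rightarrow> 'a \<Rightarrow> bool" where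
  "is_subgradient h v p \<longleftrightarrow> (\<forall>v'. h v' \<ge> h v + ereal (p \<bullet> (v' - v)))"

definition strongly_convex :: "real \<Rightarrow> ('a::real_inner \<Rightarrow> ereal) \<Rightarrow> bool" where
  "strongly_convex \<alpha> h \<longleftrightarrow>
    (\<forall>v1 v2 p. is_subgradient h v1 p \<longrightarrow>
      h v2 \<ge> h v1 + ereal (p \<bullet> (v2 - v1)) + ereal (\<alpha> / 2 * (norm (v2 - v1))\<^sup>2))"


text \<open>
  The data \<open>T, S, \<ell>, f, m\<^sub>0, g, \<pi>\<^sub>0, \<pi>\<^sub>1\<close> of the game, in this order; \<open>'a\<close> plays the
  role of \<open>\<real>\<^sup>d\<close>, which contains both the states and the controls.
\<close>

record 'a mfg =
  horizon :: nat
  states :: "'a set"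
  run_cost :: "nat \<Rightarrow> 'a \<Rightarrow> 'a \<Rightarrow> ereal"
  coupling :: "nat \<Rightarrow> 'a \<Rightarrow> ('a \<Rightarrow> real) \<Rightarrow> real"
  init_dist :: "'a \<Rightarrow> real"
  final_cost :: "'a \<Rightarrow> real"
  kernel0 :: "nat \<Rightarrow> 'a \<Rightarrow> 'a \<Rightarrow> real"
  kernel1 :: "nat \<Rightarrow> 'a \<Rightarrow> 'a \<Rightarrow> 'a"

definition mfg_data :: "'a::euclidean_space mfg \<Rightarrow> bool" where
  "mfg_data G \<longleftrightarrow> horizon G > 0 \<and> finite (states G) \<and> init_dist G \<in> prob_funs (states G) \<and>
    (\<forall>t<horizon G. \<forall>x\<in>states G. \<forall>v. run_cost G t x v \<noteq> -\<infinity>)"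

definition time_step :: "'a mfg \<Rightarrow> real" where
  "time_step G = 1 / real (horizon G)"

definition transition :: "'a::real_inner mfg \<Rightarrow> nat \<Rightarrow> 'a \<Rightarrow> 'a \<Rightarrow> 'a \<Rightarrow> real" where
  "transition G t x y \<omega> = kernel0 G t x y + time_step G * (kernel1 G t x y \<bullet> \<omega>)"

definition prob_paths :: "'a mfg \<Rightarrow> (nat \<Rightarrow> 'a \<Rightarrow> real) set" where
  "prob_paths G = {m \<in> funs_on {..horizon G} (states G). \<forall>t\<le>horizon G. m t \<in> prob_funs (states G)}"


definition assumption1 :: "'a::euclidean_space mfg \<Rightarrow> real \<Rightarrow> real \<Rightarrow> real \<Rightarrow> bool" where
  "assumption1 G D Lf \<alpha> \<longleftrightarrow>
    D > 0 \<and>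
    (\<forall>t<horizon G. \<forall>x\<in>states G.
      lower_semicont (run_cost G t x) \<and> (\<exists>v. run_cost G t x v \<noteq> \<infinity>) \<and>
      (\<forall>v. norm v > D \<longrightarrow> run_cost G t x v = \<infinity>)) \<and>
    Lf > 0 \<and>
    (\<forall>t<horizon G. \<forall>x\<in>states G. \<forall>\<mu>1\<in>prob_funs (states G). \<forall>\<mu>2\<in>prob_funs (states G).
      \<bar>coupling G t x \<mu>1 - coupling G t x \<mu>2\<bar> \<le> Lf * L2_set (\<lambda>y. \<mu>1 y - \<mu>2 y) (states G)) \<and>
    \<alpha> > 0 \<and>
    (\<forall>t<horizon G. \<forall>x\<in>states G. strongly_convex \<alpha> (run_cost G t x)) \<and>
    (\<forall>t<horizon G. \<forall>\<mu>1\<in>prob_funs (states G). \<forall>\<mu>2\<in>prob_funs (states G).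
      (\<Sum>x\<in>states G. (coupling G t x \<mu>1 - coupling G t x \<mu>2) * (\<mu>1 x - \<mu>2 x)) \<ge> 0)"

definition assumption2 :: "'a::euclidean_space mfg \<Rightarrow> real \<Rightarrow> bool" where
  "assumption2 G D \<longleftrightarrow>
    (\<forall>t<horizon G. \<forall>x\<in>states G.
      kernel0 G t x \<in> prob_funs (states G) \<and>
      (\<Sum>z\<in>states G. kernel1 G t x z) = 0 \<and>
      (\<forall>y\<in>states G. kernel0 G t x y \<ge> time_step G * D * norm (kernel1 G t x y)))"

definition assumption3 :: "'a mfg \<Rightarrow> (nat \<Rightarrow> ('a \<Rightarrow> real) \<Rightarrow> real) \<Rightarrow> bool" where
  "assumption3 G F \<longleftrightarrow>
    (\<forall>t<horizon G. \<forall>\<mu>1\<in>prob_funs (states G). \<forall>\<mu>2\<in>prob_funs (states G).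
      F t \<mu>2 - F t \<mu>1 =
        integral {0..1} (\<lambda>s. \<Sum>x\<in>states G.
          coupling G t x (\<lambda>y. \<mu>1 y + s * (\<mu>2 y - \<mu>1 y)) * (\<mu>2 x - \<mu>1 x)))"


text \<open>
  Under the assumptions on the data the infimum below is attained and finite, so that
  \<^const>\<open>real_of_ereal\<close> only changes the type.
\<close>

function HJB :: "'a::euclidean_space mfg \<Rightarrow> (nat \<Rightarrow> 'a \<Rightarrow> real) \<Rightarrow> nat \<Rightarrow> 'a \<Rightarrow> real" where
  "HJB G m t x =
    (if x \<notin> states G \<or> t > horizon G then 0
     else if t = horizon G then final_cost G x
     else real_of_ereal (INF \<omega>.
       (run_cost G t x \<omega> + ereal (coupling G t x (m t))) * ereal (time_step G)
       + ereal (\<Sum>y\<in>states G. transition G t x y \<omega> * HJB G m (Suc t) y)))"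
  by auto
termination
  by (relation "Wellfounded.measure (\<lambda>(G, m, t, x). horizon G - t)") auto

declare HJB.simps [simp del]

definition V :: "'a::euclidean_space mfg \<Rightarrow> (nat \<Rightarrow> 'a \<Rightarrow> real) \<Rightarrow> nat \<Rightarrow> 'a \<Rightarrow> 'a" where
  "V G u t x =
    (if t < horizon G \<and> x \<in> states G
     then arg_min (\<lambda>\<omega>. run_cost G t x \<omega> * ereal (time_step G)
            + ereal (\<Sum>y\<in>states G. transition G t x y \<omega> * u (Suc t) y)) (\<lambda>_. True)
     else 0)"

primrec FP :: "'a::euclidean_space mfg \<Rightarrow> (nat \<Rightarrow> 'a \<Rightarrow> 'a) \<Rightarrow> nat \<Rightarrow> 'a \<Rightarrow> real" where
  "FP G v 0 = init_dist G"
| "FP G v (Suc t) = (\<lambda>y. if t < horizon G \<and> y \<in> states G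
     then (\<Sum>x\<in>states G. transition G t x y (v t x) * FP G v t x) else 0)"

definition mfg_solution ::
  "'a::euclidean_space mfg \<Rightarrow> (nat \<Rightarrow> 'a \<Rightarrow> real) \<Rightarrow> (nat \<Rightarrow> 'a \<Rightarrow> 'a) \<Rightarrow> (nat \<Rightarrow> 'a \<Rightarrow> real) \<Rightarrow> bool"
where
  "mfg_solution G u v m \<longleftrightarrow> m \<in> prob_paths G \<and> u = HJB G m \<and> v = V G u \<and> m = FP G v"


definition flux :: "(nat \<Rightarrow> 'a \<Rightarrow> real) \<Rightarrow> (nat \<Rightarrow> 'a \<Rightarrow> 'b) \<Rightarrow> nat \<Rightarrow> 'a \<Rightarrow> 'b::real_vector" where
  "flux m v = (\<lambda>t x. m t x *\<^sub>R v t x)"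

definition admissible ::
  "'a::euclidean_space mfg \<Rightarrow> real \<Rightarrow> ((nat \<Rightarrow> 'a \<Rightarrow> real) \<times> (nat \<Rightarrow> 'a \<Rightarrow> 'a)) set" where
  "admissible G D = {(m, v). m \<in> prob_paths G \<and> v \<in> funs_on {..<horizon G} (states G) \<and>
    m = FP G v \<and> norm_inf_inf {..<horizon G} (states G) v \<le> D}"

definition admissible_flux ::
  "'a::euclidean_space mfg \<Rightarrow> real \<Rightarrow> ((nat \<Rightarrow> 'a \<Rightarrow> real) \<times> (nat \<Rightarrow> 'a \<Rightarrow> 'a)) set" where
  "admissible_flux G D = {(m, flux m v) | m v. (m, v) \<in> admissible G D}"

definition run_cost_flux ::
  "'a::euclidean_space mfg \<Rightarrow> (nat \<Rightarrow> 'a \<Rightarrow> real) \<Rightarrow> (nat \<Rightarrow> 'a \<Rightarrow> 'a) \<Rightarrow> nat \<Rightarrow> 'a \<Rightarrow> ereal" where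
  "run_cost_flux G m w t x =
    (if m t x \<noteq> 0 then run_cost G t x (w t x /\<^sub>R m t x) * ereal (m t x)
     else if w t x = 0 then 0
     else \<infinity>)"

definition total_cost ::
  "'a::euclidean_space mfg \<Rightarrow> (nat \<Rightarrow> ('a \<Rightarrow> real) \<Rightarrow> real) \<Rightarrow>
    (nat \<Rightarrow> 'a \<Rightarrow> real) \<Rightarrow> (nat \<Rightarrow> 'a \<Rightarrow> 'a) \<Rightarrow> ereal" where
  "total_cost G F m w =
    ereal (time_step G) * (\<Sum>t<horizon G. \<Sum>x\<in>states G. run_cost_flux G m w t x)
    + ereal (time_step G * (\<Sum>t<horizon G. F t (m t)))
    + ereal (\<Sum>x\<in>states G. final_cost G x * m (horizon G) x)"

definition frozen_cost ::
  "'a::euclidean_space mfg \<Rightarrow> (nat \<Rightarrow> 'a \<Rightarrow> real) \<Rightarrow>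
    (nat \<Rightarrow> 'a \<Rightarrow> real) \<Rightarrow> (nat \<Rightarrow> 'a \<Rightarrow> 'a) \<Rightarrow> ereal" where
  "frozen_cost G m' m w =
    ereal (time_step G) * (\<Sum>t<horizon G. \<Sum>x\<in>states G.
      run_cost_flux G m w t x + ereal (coupling G t x (m' t) * m t x))
    + ereal (\<Sum>x\<in>states G. final_cost G x * m (horizon G) x)"


text \<open>Both suprema are taken in \<open>\<real>\<close>, over non-empty sets that are bounded under the assumptions.\<close>

definition const_C1 :: "'a::euclidean_space mfg \<Rightarrow> real \<Rightarrow> real" where
  "const_C1 G D =
    (SUP v \<in> {v \<in> funs_on {..<horizon G} (states G). norm_inf_inf {..<horizon G} (states G) v \<le> D}.
      (norm_inf_2 {..horizon G} (states G) (FP G v))\<^sup>2)"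

definition const_C2 :: "'a::euclidean_space mfg \<Rightarrow> real" where
  "const_C2 G =
    (SUP m \<in> prob_paths G. norm_inf_inf {..horizon G} (states G) (FP G (V G (HJB G m))))"

definition stability_const :: "'a::euclidean_space mfg \<Rightarrow> real \<Rightarrow> real \<Rightarrow> bool" where
  "stability_const G D C3 \<longleftrightarrow> C3 > 0 \<and>
    (\<forall>(m1, v1) \<in> admissible G D. \<forall>(m2, v2) \<in> admissible G D.
      (norm_inf_2 {..horizon G} (states G) (\<lambda>t x. m1 t x - m2 t x))\<^sup>2
      \<le> C3 * time_step G *
        (\<Sum>t<horizon G. \<Sum>x\<in>states G. (norm (m1 t x *\<^sub>R (v1 t x - v2 t x)))\<^sup>2))"

definition const_D1 :: "'a::euclidean_space mfg \<Rightarrow> real \<Rightarrow> real \<Rightarrow> real" where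
  "const_D1 G D Lf = const_C1 G D * Lf * sqrt (real (card (states G)))"

definition const_c :: "'a::euclidean_space mfg \<Rightarrow> real \<Rightarrow> real \<Rightarrow> real \<Rightarrow> real" where
  "const_c G Lf \<alpha> C3 =
    max (1 - \<alpha> / (4 * const_C2 G * C3 * Lf * sqrt (real (card (states G))))) (1 / 2)"


definition BR ::
  "'a::euclidean_space mfg \<Rightarrow> (nat \<Rightarrow> 'a \<Rightarrow> real) \<Rightarrow> (nat \<Rightarrow> 'a \<Rightarrow> real) \<times> (nat \<Rightarrow> 'a \<Rightarrow> 'a)" where
  "BR G m' = (let v = V G (HJB G m'); m = FP G v in (m, flux m v))"

definition frank_wolfe ::
  "'a::euclidean_space mfg \<Rightarrow> real \<Rightarrow> (nat \<Rightarrow> real) \<Rightarrow>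
    (nat \<Rightarrow> nat \<Rightarrow> 'a \<Rightarrow> real) \<Rightarrow> (nat \<Rightarrow> nat \<Rightarrow> 'a \<Rightarrow> 'a) \<Rightarrow> bool" where
  "frank_wolfe G D lam m w \<longleftrightarrow>
    (m 0, w 0) \<in> admissible_flux G D \<and>
    (m 1, w 1) = BR G (m 0) \<and>
    (\<forall>k\<ge>1. lam k \<in> {0..1} \<and>
      (case BR G (m k) of (mb, wb) \<Rightarrow>
        m (Suc k) = (\<lambda>t x. (1 - lam k) * m k t x + lam k * mb t x) \<and>
        w (Suc k) = (\<lambda>t x. (1 - lam k) *\<^sub>R w k t x + lam k *\<^sub>R wb t x)))"

text \<open>
  The step size of the linearly convergent variant. The minimum is formed in the extended reals
  because the costs are extended real-valued; its value is the real number \<open>lam k\<close>.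
\<close>

definition adaptive_steps ::
  "'a::euclidean_space mfg \<Rightarrow> real \<Rightarrow> (nat \<Rightarrow> real) \<Rightarrow>
    (nat \<Rightarrow> nat \<Rightarrow> 'a \<Rightarrow> real) \<Rightarrow> (nat \<Rightarrow> nat \<Rightarrow> 'a \<Rightarrow> 'a) \<Rightarrow> bool" where
  "adaptive_steps G Lf lam m w \<longleftrightarrow>
    (\<forall>k\<ge>1. case BR G (m k) of (mb, wb) \<Rightarrow>
      ereal (lam k) =
        (if m k = mb then 1
         else min ((frozen_cost G (m k) (m k) (w k) - frozen_cost G (m k) mb wb)
                / ereal (Lf * sqrt (real (card (states G))) *
                    (norm_inf_2 {..horizon G} (states G) (\<lambda>t x. m k t x - mb t x))\<^sup>2)) 1))"

end

theory Submission
  imports Defs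
begin

text \<open>
  The argument is that of Frank--Wolfe (conditional gradient) minimisation of the potential
  \<open>J\<close> = \<^const>\<open>total_cost\<close>, seen as a function of the pair (distribution, flux). In these
  variables the dynamics are linear and the running cost is a perspective function, hence jointly
  convex, so the iterates are again generated by controls in the domain of the running cost
  (\<open>policy_mixture\<close>). All costs of such pairs are finite, and the whole analysis can be done with
  the real-valued \<open>total_value\<close> and \<open>frozen_value\<close>.

  Freezing the coupling at a path \<open>m\<close> linearises the potential at \<open>m\<close>. Monotonicity of the
  coupling says that its potential \<open>F\<close> lies above its linearisations, and Lipschitz continuity
  bounds the error by a multiple of the squared distance. Both facts are combined in the
  single inequality \<open>total_value_diff_le\<close>, for two arbitrary controls and an arbitrary freezing
  path \<open>m\<close>, with \<open>L\<close> = \<open>smoothness\<close>: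
  \<open>J(v) - J(v') \<le> J\<^sub>m(v) - J\<^sub>m(v') + L/2 \<parallel>FP(v) - m\<parallel>\<^sup>2\<close>.
  Choosing \<open>m\<close> gives everything needed about the potential. With \<open>m = FP(v)\<close> the duality gap
  \<open>\<sigma> = J\<^sub>m(v) - J\<^sub>m(best response)\<close> dominates the optimality gap \<open>\<epsilon>\<close>; at the equilibrium
  the duality gap is zero, so the equilibrium is a global minimiser. With \<open>m\<close> the current iterate
  and \<open>v\<close> the next one it becomes the descent estimate
  \<open>\<epsilon>' \<le> \<epsilon> - \<lambda> \<sigma> + \<lambda>\<^sup>2 L/2 \<parallel>m - best response\<parallel>\<^sup>2\<close>. With \<open>m\<close> the starting
  path and \<open>v\<close> its best response it bounds the first optimality gap even when
  the starting pair has infinite cost.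

  Since all paths have squared norm at most \<open>C\<^sub>1\<close>, the quadratic term is at most
  \<open>2 D\<^sub>1 \<lambda>\<^sup>2\<close>, and the step sizes \<open>2/(k+2)\<close> yield the sublinear rate by induction. For the
  linear rate, strong convexity of the running cost enters through dynamic programming: the excess
  of the frozen cost of a control over that of the best response is the expected sum of its
  Bellman gaps, and each Bellman gap is at least \<open>\<alpha>/2 \<Delta>t\<close> times the squared distance of
  the controls (\<open>frozen_value_growth\<close>). With the stability constant \<open>C\<^sub>3\<close> and the bound
  \<open>C\<^sub>2\<close> on the iterates this gives
  \<open>\<parallel>m - best response\<parallel>\<^sup>2 \<le> 2 C\<^sub>2 C\<^sub>3 / \<alpha> \<sigma>\<close>, so that a step that minimises the
  right-hand side of the descent estimate contracts the optimality gap by the factor \<open>c\<close>.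

  Strong convexity is postulated only at points that possess a subgradient. That such a lower
  semicontinuous function with bounded domain is convex in the ordinary sense, as the perspective
  function requires, is \<open>strongly_convex_imp_convex\<close>.
\<close>

section \<open>Strong convexity tested on subgradients\<close>

lemma lower_semicont_sequentially:
  assumes "lower_semicont h" "X \<longlonglongrightarrow> l" "C < h l"
  shows "\<forall>\<^sub>F n in sequentially. C < h (X n)"
proof -
  have "\<forall>\<^sub>F y in at l. C < h y"
    using assms(1,3) unfolding lower_semicont_def le_Liminf_iff by blast
  then have "\<forall>\<^sub>F y in nhds l. C < h y"
    using assms(3) by (simp add: eventually_nhds_conv_at)
  then show ?thesis
    using assms(2) by (rule eventually_compose_filterlim)
qed

text \<open>
  The direct method: a minimising sequence lies in the compact ball that contains the domain, and
  a cluster point of it is a minimiser by lower semicontinuity.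
\<close>
lemma lower_semicont_perturbed_minimizer:
  fixes h :: "'a::euclidean_space \<Rightarrow> ereal" and q :: "'a \<Rightarrow> real"
  assumes lsc: "lower_semicont h" and bdd: "\<And>v. norm v > D \<Longrightarrow> h v = \<infinity>"
    and cont: "continuous_on UNIV q" and a: "h a \<noteq> \<infinity>"
  obtains v where "h v \<noteq> \<infinity>" "\<And>v'. h v + ereal (q v) \<le> h v' + ereal (q v')"
proof -
  define g where "g v = h v + ereal (q v)" for v
  define I where "I = Inf (g ` {v. h v \<noteq> \<infinity>})"
  have "g ` {v. h v \<noteq> \<infinity>} \<noteq> {}" using a by blast
  then obtain u where u: "\<And>n. u n \<in> g ` {v. h v \<noteq> \<infinity>}" and lim: "u \<longlonglongrightarrow> I"
    using Inf_as_limit[of "g ` {v. h v \<noteq> \<infinity>}", folded I_def] by blast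
  have "\<forall>n. \<exists>v. h v \<noteq> \<infinity> \<and> u n = g v" using u by blast
  then obtain X where X: "\<And>n. h (X n) \<noteq> \<infinity>" "\<And>n. u n = g (X n)" by metis
  have "X n \<in> cball 0 D" for n
    using X(1)[of n] bdd[of "X n"] by (metis mem_cball_0 not_le)
  then obtain l r where r: "strict_mono r" "(X \<circ> r) \<longlonglongrightarrow> l"
    using compact_cball[of "0::'a" D, unfolded compact_def] by blast
  have limg: "(\<lambda>n. g (X (r n))) \<longlonglongrightarrow> I"
    using LIMSEQ_subseq_LIMSEQ[OF lim r(1)] X(2) by (simp add: o_def)
  have gl: "g l \<le> I"
  proof (rule ccontr)
    assume "\<not> g l \<le> I"
    then obtain C where C: "I < ereal C" "ereal C < g l" using ereal_dense2 by (metis not_le)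
    \<comment> \<open>The margin between the infimum and the value at the limit is divided between \<open>h\<close> and \<open>q\<close>.\<close>
    have "ereal (C - q l) < h l"
      using C(2) by (cases "h l") (auto simp: g_def)
    then obtain C' where C': "ereal (C - q l) < ereal C'" "ereal C' < h l"
      using ereal_dense2 by blast
    have e1: "\<forall>\<^sub>F n in sequentially. ereal C' < h (X (r n))"
      using lower_semicont_sequentially[OF lsc r(2) C'(2)] by simp
    have "(\<lambda>n. q (X (r n))) \<longlonglongrightarrow> q l"
      using continuous_on_tendsto_compose[OF cont r(2)] by (simp add: o_def)
    then have e2: "\<forall>\<^sub>F n in sequentially. C - C' < q (X (r n))"
      by (rule order_tendstoD) (use C'(1) in simp)
    have e3: "\<forall>\<^sub>F n in sequentially. g (X (r n)) < ereal C"
      by (rule order_tendstoD(2)[OF limg C(1)])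
    have "\<forall>\<^sub>F n in sequentially. False"
      using e1 e2 e3
    proof eventually_elim
      case (elim n)
      then show ?case
        by (cases "h (X (r n))") (auto simp: g_def)
    qed
    then show False by simp
  qed
  have Ile: "I \<le> g v" if "h v \<noteq> \<infinity>" for v
    unfolding I_def using that by (auto intro: Inf_lower)
  have "h l \<noteq> \<infinity>"
    using gl Ile[OF a] a by (auto simp: g_def)
  moreover have "g l \<le> g v'" for v'
    using gl Ile[of v'] by (cases "h v' = \<infinity>") (auto simp: g_def intro: order_trans)
  ultimately show thesis using that by (auto simp: g_def)
qed

text \<open>
  Fermat's rule for a perturbation by an affine function. The factor \<open>c\<close> is the time step when the
  rule is applied to the minimisation over controls.
\<close>
lemma minimizer_imp_subgradient:
  assumes ninf: "\<And>v. h v \<noteq> -\<infinity>" and fin: "h v \<noteq> \<infinity>" and c: "c > 0"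
    and min: "\<And>v'. h v * ereal c + ereal (b + p \<bullet> v) \<le> h v' * ereal c + ereal (b + p \<bullet> v')"
  shows "is_subgradient h v (- (p /\<^sub>R c))"
  unfolding is_subgradient_def
proof
  fix v'
  obtain r where r: "h v = ereal r" using ninf[of v] fin by (cases "h v") auto
  show "h v + ereal (- (p /\<^sub>R c) \<bullet> (v' - v)) \<le> h v'"
  proof (cases "h v'")
    case (real r')
    have "r * c + p \<bullet> v \<le> r' * c + p \<bullet> v'" using min[of v'] r real by simp
    then have "r - inverse c * (p \<bullet> (v' - v)) \<le> r'"
      using c by (simp add: field_simps inner_diff_right)
    then show ?thesis using r real by simp
  qed (use ninf[of v'] in auto)
qed

lemma strongly_convex_growth:
  assumes ninf: "\<And>v. h v \<noteq> -\<infinity>" and sc: "strongly_convex \<alpha> h"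
    and sub: "is_subgradient h v p" and fin: "h v \<noteq> \<infinity>" "h v' \<noteq> \<infinity>"
  shows "real_of_ereal (h v) + p \<bullet> (v' - v) + \<alpha> / 2 * (norm (v' - v))\<^sup>2 \<le> real_of_ereal (h v')"
proof -
  have "h v + ereal (p \<bullet> (v' - v)) + ereal (\<alpha> / 2 * (norm (v' - v))\<^sup>2) \<le> h v'"
    using sc sub unfolding strongly_convex_def by blast
  then show ?thesis
    using fin ninf[of v] ninf[of v'] by (cases "h v"; cases "h v'") auto
qed

text \<open>
  For every slope \<open>p\<close> the tilted function \<open>h - p\<close> attains its minimum, at a point \<open>v(p)\<close> where
  \<open>p\<close> is a subgradient of \<open>h\<close>. The growth condition makes \<open>v\<close> Lipschitz continuous, so for
  every \<open>\<epsilon> > 0\<close> the equation \<open>v(p) + \<epsilon> p = x\<close> is solvable by Brouwer's theorem. Its solution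
  gives points \<open>v(p)\<close> near \<open>x\<close> that carry a subgradient, at which the convexity inequality is
  immediate; it even leaves \<open>\<epsilon> \<parallel>p\<parallel>\<^sup>2\<close> to spare, which is what forces \<open>v(p)\<close> to tend to
  \<open>x\<close> as \<open>\<epsilon>\<close> tends to zero. Lower semicontinuity then transfers the inequality to \<open>x\<close>.
  (This is Moreau--Yosida regularisation, with \<open>v(p)\<close> the proximal point of \<open>x\<close>.)
\<close>
lemma strongly_convex_imp_convex:
  fixes h :: "'a::euclidean_space \<Rightarrow> ereal"
  assumes lsc: "lower_semicont h" and bdd: "\<And>v. norm v > D \<Longrightarrow> h v = \<infinity>"
    and ninf: "\<And>v. h v \<noteq> -\<infinity>" and sc: "strongly_convex \<alpha> h" and \<alpha>: "\<alpha> > 0"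
    and a: "h a \<noteq> \<infinity>" and b: "h b \<noteq> \<infinity>" and s: "0 \<le> s" "s \<le> 1"
  shows "h ((1 - s) *\<^sub>R a + s *\<^sub>R b)
    \<le> ereal ((1 - s) * real_of_ereal (h a) + s * real_of_ereal (h b))"
proof -
  define r where "r v = real_of_ereal (h v)" for v
  define x where "x = (1 - s) *\<^sub>R a + s *\<^sub>R b"
  define M where "M = (1 - s) * r a + s * r b"
  have "\<exists>v. h v \<noteq> \<infinity> \<and> is_subgradient h v p" for p
  proof -
    have "continuous_on UNIV (\<lambda>v. (- p) \<bullet> v)" by (intro continuous_intros)
    then obtain v where v: "h v \<noteq> \<infinity>" "\<And>v'. h v + ereal ((- p) \<bullet> v) \<le> h v' + ereal ((- p) \<bullet> v')"
      using lower_semicont_perturbed_minimizer[OF lsc bdd _ a] by blast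
    have "is_subgradient h v (- ((- p) /\<^sub>R 1))"
      by (rule minimizer_imp_subgradient[where b = 0]) (use ninf v in auto)
    then show ?thesis using v(1) by auto
  qed
  then obtain vf where vf: "\<And>p. h (vf p) \<noteq> \<infinity>" "\<And>p. is_subgradient h (vf p) p" by metis
  have growth: "r (vf p) + p \<bullet> (z - vf p) + \<alpha> / 2 * (norm (z - vf p))\<^sup>2 \<le> r z"
    if "h z \<noteq> \<infinity>" for p z
    unfolding r_def by (rule strongly_convex_growth[OF ninf sc vf(2) vf(1) that])
  have sub: "r (vf p) + p \<bullet> (z - vf p) \<le> r z" if "h z \<noteq> \<infinity>" for p z
  proof -
    have "0 \<le> \<alpha> / 2 * (norm (z - vf p))\<^sup>2" using \<alpha> by simp
    then show ?thesis using growth[OF that, of p] by linarith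
  qed
  \<comment> \<open>Adding the growth conditions at the two points gives strong monotonicity of \<open>p \<mapsto> v(p)\<close>.\<close>
  have lip: "norm (vf p - vf q) \<le> norm (p - q) / \<alpha>" for p q
  proof -
    define d where "d = vf p - vf q"
    have "r (vf p) + p \<bullet> (- d) + \<alpha> / 2 * (norm d)\<^sup>2 \<le> r (vf q)"
      using growth[OF vf(1)[of q], of p] by (simp add: d_def norm_minus_commute)
    moreover have "r (vf q) + q \<bullet> d + \<alpha> / 2 * (norm d)\<^sup>2 \<le> r (vf p)"
      using growth[OF vf(1)[of p], of q] by (simp add: d_def)
    ultimately have "\<alpha> * (norm d)\<^sup>2 \<le> (p - q) \<bullet> d" by (simp add: inner_diff_left)
    also have "\<dots> \<le> norm (p - q) * norm d" by (rule norm_cauchy_schwarz)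
    finally have "\<alpha> * norm d * norm d \<le> norm (p - q) * norm d"
      by (simp add: power2_eq_square mult.assoc)
    then have "\<alpha> * norm d \<le> norm (p - q)"
      by (cases "norm d = 0") auto
    then show ?thesis using \<alpha> by (simp add: d_def field_simps)
  qed
  have cont: "continuous_on UNIV vf"
  proof (rule continuous_onI)
    fix p and e :: real assume e: "0 < e"
    show "\<exists>d>0. \<forall>p'\<in>UNIV. dist p' p < d \<longrightarrow> dist (vf p') (vf p) \<le> e"
    proof (intro exI conjI ballI impI)
      show "0 < e * \<alpha>" using e \<alpha> by simp
      fix p' assume "dist p' p < e * \<alpha>"
      then have "norm (p' - p) / \<alpha> \<le> e" using \<alpha> by (simp add: dist_norm field_simps)
      then show "dist (vf p') (vf p) \<le> e"
        unfolding dist_norm by (rule order_trans[OF lip])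
    qed
  qed
  have bound: "norm (vf p) \<le> D" for p
    using bdd[of "vf p"] vf(1)[of p] by (metis not_le)
  have D0: "0 \<le> D" using bound[of 0] norm_ge_zero[of "vf 0"] by linarith
  have ex: "\<exists>p. vf p + \<epsilon> *\<^sub>R p = x" if "\<epsilon> > 0" for \<epsilon>
  proof -
    \<comment> \<open>Since \<open>v\<close> is bounded by \<open>D\<close>, the map \<open>p \<mapsto> (x - v(p)) / \<epsilon>\<close> has its values in the ball of radius \<open>R\<close>.\<close>
    define R where "R = (norm x + D) / \<epsilon> + 1"
    have R: "R > 0" using D0 that by (simp add: R_def add_nonneg_pos)
    have "\<exists>p\<in>cball 0 R. (x - vf p) /\<^sub>R \<epsilon> = p"
    proof (rule brouwer_ball[OF R])
      show "continuous_on (cball 0 R) (\<lambda>p. (x - vf p) /\<^sub>R \<epsilon>)"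
        by (intro continuous_intros continuous_on_subset[OF cont]) auto
      show "(\<lambda>p. (x - vf p) /\<^sub>R \<epsilon>) \<in> cball 0 R \<rightarrow> cball 0 R"
      proof
        fix p
        have "norm (x - vf p) \<le> norm x + D"
          using norm_triangle_ineq4[of x "vf p"] bound[of p] by linarith
        then have "norm (x - vf p) / \<epsilon> \<le> (norm x + D) / \<epsilon>"
          using that by (simp add: divide_right_mono)
        moreover have "norm ((x - vf p) /\<^sub>R \<epsilon>) = norm (x - vf p) / \<epsilon>"
          using that by (simp add: divide_inverse mult.commute)
        ultimately have "norm ((x - vf p) /\<^sub>R \<epsilon>) \<le> R" unfolding R_def by linarith
        then show "(x - vf p) /\<^sub>R \<epsilon> \<in> cball 0 R" by simp
      qed
    qed blast
    then obtain p where "(x - vf p) /\<^sub>R \<epsilon> = p" by blast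
    then have "\<epsilon> *\<^sub>R ((x - vf p) /\<^sub>R \<epsilon>) = \<epsilon> *\<^sub>R p" by (rule arg_cong)
    then have "\<epsilon> *\<^sub>R p = x - vf p" using that by simp
    then show ?thesis by (intro exI[of _ p]) simp
  qed
  define e where "e n = 1 / real (Suc n)" for n
  have e_pos: "0 < e n" for n by (simp add: e_def)
  have e_lim: "e \<longlonglongrightarrow> 0"
    unfolding e_def[abs_def] using LIMSEQ_inverse_real_of_nat by (simp only: inverse_eq_divide)
  have "\<forall>n. \<exists>p. vf p + e n *\<^sub>R p = x" using ex e_pos by blast
  then obtain p where p: "\<And>n. vf (p n) + e n *\<^sub>R p n = x" by metis
  define X where "X n = vf (p n)" for n
  have key: "r (X n) + e n * (norm (p n))\<^sup>2 \<le> M" for n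
  proof -
    define v where "v = vf (p n)"
    have 1: "(1 - s) * (r v + p n \<bullet> (a - v)) \<le> (1 - s) * r a"
      using s sub[OF a, of "p n"] by (intro mult_left_mono) (auto simp: v_def)
    have 2: "s * (r v + p n \<bullet> (b - v)) \<le> s * r b"
      using s sub[OF b, of "p n"] by (intro mult_left_mono) (auto simp: v_def)
    have "(1 - s) * (p n \<bullet> (a - v)) + s * (p n \<bullet> (b - v)) = p n \<bullet> (x - v)"
      by (simp add: x_def inner_diff_right inner_add_right algebra_simps)
    moreover have "x - v = e n *\<^sub>R p n"
      using p[of n] by (simp add: v_def algebra_simps)
    ultimately have "(1 - s) * (p n \<bullet> (a - v)) + s * (p n \<bullet> (b - v))
        = e n * (norm (p n))\<^sup>2"
      by (simp add: power2_norm_eq_inner)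
    then show ?thesis using 1 2 by (simp add: M_def X_def v_def algebra_simps)
  qed
  \<comment> \<open>The value at the slope zero is the minimum of \<open>h\<close>, so \<open>key\<close> bounds
     \<open>e n\<close> times the squared slope uniformly.\<close>
  have "norm (X n - x) \<le> sqrt (e n * (M - r (vf 0)))" for n
  proof (rule real_le_rsqrt)
    have "norm (X n - x) = e n * norm (p n)"
    proof -
      have "X n - x = - (e n *\<^sub>R p n)" using p[of n] by (simp add: X_def algebra_simps)
      then show ?thesis using e_pos[of n] by simp
    qed
    then have "(norm (X n - x))\<^sup>2 = e n * (e n * (norm (p n))\<^sup>2)"
      by (simp add: power_mult_distrib power2_eq_square)
    also have "\<dots> \<le> e n * (M - r (vf 0))"
    proof (rule mult_left_mono)
      show "e n * (norm (p n))\<^sup>2 \<le> M - r (vf 0)"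
        using key[of n] sub[OF vf(1)[of "p n"], of 0] by (simp add: X_def)
    qed (use e_pos[of n] in simp)
    finally show "(norm (X n - x))\<^sup>2 \<le> e n * (M - r (vf 0))" .
  qed
  moreover have "(\<lambda>n. sqrt (e n * (M - r (vf 0)))) \<longlonglongrightarrow> 0"
    using tendsto_real_sqrt[OF tendsto_mult[OF e_lim tendsto_const[of "M - r (vf 0)"]]] by simp
  ultimately have "(\<lambda>n. X n - x) \<longlonglongrightarrow> 0"
    by (rule Lim_null_comparison[OF always_eventually, OF allI])
  then have limX: "X \<longlonglongrightarrow> x" by (simp add: LIM_zero_iff)
  have "h x \<le> ereal M"
  proof (rule ccontr)
    assume "\<not> h x \<le> ereal M"
    then have "\<forall>\<^sub>F n in sequentially. ereal M < h (X n)"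
      by (intro lower_semicont_sequentially[OF lsc limX]) auto
    then obtain n where n: "ereal M < h (X n)"
      using eventually_happens'[OF sequentially_bot] by blast
    have "0 \<le> e n * (norm (p n))\<^sup>2" using e_pos[of n] by simp
    with key[of n] have "r (X n) \<le> M" by linarith
    then show False using n vf(1)[of "p n"] ninf[of "X n"]
      by (cases "h (X n)") (auto simp: r_def X_def)
  qed
  then show ?thesis by (simp add: x_def M_def r_def)
qed

section \<open>The maximum-in-time norm and probability vectors\<close>

lemma L2_set_le_norm_inf_2:
  fixes \<mu> :: "nat \<Rightarrow> 'a \<Rightarrow> real"
  assumes "t \<le> n"
  shows "L2_set (\<mu> t) S \<le> norm_inf_2 {..n} S \<mu>"
proof -
  have "L2_set (\<mu> t) S = L2_set (\<lambda>x. norm (\<mu> t x)) S" by (simp add: L2_set_def)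
  also have "\<dots> \<le> norm_inf_2 {..n} S \<mu>"
    unfolding norm_inf_2_def using assms by (intro Max_ge) auto
  finally show ?thesis .
qed

lemma norm_inf_2_leI:
  fixes \<mu> :: "nat \<Rightarrow> 'a \<Rightarrow> real"
  assumes "\<And>t. t \<le> n \<Longrightarrow> L2_set (\<mu> t) S \<le> c"
  shows "norm_inf_2 {..n} S \<mu> \<le> c"
proof -
  have "L2_set (\<lambda>x. norm (\<mu> t x)) S = L2_set (\<mu> t) S" for t by (simp add: L2_set_def)
  then show ?thesis unfolding norm_inf_2_def using assms by (subst Max_le_iff) auto
qed

lemma norm_inf_2_nonneg:
  fixes \<mu> :: "nat \<Rightarrow> 'a \<Rightarrow> real"
  shows "0 \<le> norm_inf_2 {..n} S \<mu>"
  using L2_set_le_norm_inf_2[of 0 n \<mu> S] L2_set_nonneg[of "\<mu> 0" S] by linarith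

lemma norm_inf_2_diff_le:
  fixes \<mu> \<nu> :: "nat \<Rightarrow> 'a \<Rightarrow> real"
  shows "norm_inf_2 {..n} S (\<lambda>t x. \<mu> t x - \<nu> t x) \<le> norm_inf_2 {..n} S \<mu> + norm_inf_2 {..n} S \<nu>"
proof (rule norm_inf_2_leI)
  fix t assume t: "t \<le> n"
  have "L2_set (\<lambda>x. \<mu> t x + - \<nu> t x) S \<le> L2_set (\<mu> t) S + L2_set (\<lambda>x. - \<nu> t x) S"
    by (rule L2_set_triangle_ineq)
  moreover have "L2_set (\<lambda>x. - \<nu> t x) S = L2_set (\<nu> t) S" by (simp add: L2_set_def)
  ultimately show "L2_set (\<lambda>x. \<mu> t x - \<nu> t x) S \<le> norm_inf_2 {..n} S \<mu> + norm_inf_2 {..n} S \<nu>"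
    using L2_set_le_norm_inf_2[OF t, of \<mu> S] L2_set_le_norm_inf_2[OF t, of \<nu> S] by simp
qed

lemma norm_inf_2_scale_le:
  fixes \<mu> :: "nat \<Rightarrow> 'a \<Rightarrow> real"
  shows "norm_inf_2 {..n} S (\<lambda>t x. c * \<mu> t x) \<le> \<bar>c\<bar> * norm_inf_2 {..n} S \<mu>"
proof (rule norm_inf_2_leI)
  fix t assume t: "t \<le> n"
  have "L2_set (\<lambda>x. c * \<mu> t x) S = \<bar>c\<bar> * L2_set (\<mu> t) S"
    by (simp add: L2_set_def power_mult_distrib sum_distrib_left[symmetric] real_sqrt_mult)
  also have "\<dots> \<le> \<bar>c\<bar> * norm_inf_2 {..n} S \<mu>"
    using L2_set_le_norm_inf_2[OF t] by (intro mult_left_mono) auto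
  finally show "L2_set (\<lambda>x. c * \<mu> t x) S \<le> \<bar>c\<bar> * norm_inf_2 {..n} S \<mu>" .
qed

lemma prob_funs_convex:
  assumes "\<mu> \<in> prob_funs S" "\<nu> \<in> prob_funs S" "0 \<le> s" "s \<le> 1"
  shows "(\<lambda>y. \<mu> y + s * (\<nu> y - \<mu> y)) \<in> prob_funs S"
proof -
  have eq: "\<mu> y + s * (\<nu> y - \<mu> y) = (1 - s) * \<mu> y + s * \<nu> y" for y by (simp add: algebra_simps)
  show ?thesis
    using assms unfolding eq prob_funs_def
    by (auto simp: sum.distrib sum_distrib_left[symmetric])
qed

lemma prob_funs_le_1:
  assumes "finite S" "\<mu> \<in> prob_funs S"
  shows "\<mu> x \<le> 1"
proof (cases "x \<in> S")
  case True
  have "\<mu> x \<le> (\<Sum>y\<in>S. \<mu> y)"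
    using assms True by (intro member_le_sum) (auto simp: prob_funs_def)
  then show ?thesis using assms by (simp add: prob_funs_def)
qed (use assms in \<open>auto simp: prob_funs_def\<close>)

lemma prob_funs_nonneg: "\<mu> \<in> prob_funs S \<Longrightarrow> 0 \<le> \<mu> x"
  by (cases "x \<in> S") (auto simp: prob_funs_def)

lemma prob_funs_L2_set_le_1:
  assumes "finite S" "\<mu> \<in> prob_funs S"
  shows "L2_set \<mu> S \<le> 1"
proof -
  have "L2_set \<mu> S \<le> sum \<mu> S"
    using assms by (intro L2_set_le_sum) (auto simp: prob_funs_def)
  then show ?thesis using assms by (simp add: prob_funs_def)
qed

section \<open>One step with the adaptive step size\<close>

text \<open>
  Here \<open>\<epsilon>\<close> is the optimality gap, \<open>\<sigma>\<close> the duality gap and \<open>N\<close> the squared distance to the best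
  response. The step size minimises the right-hand side of the descent estimate over \<open>[0, 1]\<close>. If
  the minimum is at the end point \<open>1\<close>, the quadratic term is at most \<open>\<sigma>/2\<close> and the gap is
  halved; otherwise the decrease is \<open>\<sigma>\<^sup>2 / (2 L N)\<close>, which is at least \<open>\<sigma> / (2 L K)\<close>.
\<close>
lemma adaptive_step_contraction:
  fixes \<epsilon> \<epsilon>' \<sigma> N L K s :: real
  assumes le: "\<epsilon> \<le> \<sigma>" and nn: "0 \<le> \<epsilon>" and N: "0 \<le> N" "N \<le> K * \<sigma>" and LK: "0 < L" "0 < K"
    and s: "s = (if N = 0 then 1 else min (\<sigma> / (L * N)) 1)"
    and step: "\<epsilon>' \<le> \<epsilon> - s * \<sigma> + s\<^sup>2 * (L / 2 * N)"
  shows "\<epsilon>' \<le> max (1 - 1 / (2 * L * K)) (1 / 2) * \<epsilon>"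
proof -
  consider "L * N \<le> \<sigma>" | "\<sigma> < L * N" by linarith
  then show ?thesis
  proof cases
    case 1
    have "s = 1"
      using s 1 LK N by (auto simp: min_def field_simps)
    then have "\<epsilon>' \<le> 1 / 2 * \<epsilon>" using step 1 le by simp
    also have "\<dots> \<le> max (1 - 1 / (2 * L * K)) (1 / 2) * \<epsilon>"
      using nn by (intro mult_right_mono) auto
    finally show ?thesis .
  next
    case 2
    then have Npos: "0 < N" using N le nn by (cases "N = 0") auto
    have LN: "0 < L * N" using Npos LK by simp
    have s2: "s = \<sigma> / (L * N)" using s 2 Npos LN by (simp add: min_def)
    have "s * \<sigma> - s\<^sup>2 * (L / 2 * N) = \<sigma> * \<sigma> / (2 * L * N)"
      using LN unfolding s2 by (simp add: power2_eq_square field_simps)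
    moreover have "\<sigma> / (2 * L * K) \<le> \<sigma> * \<sigma> / (2 * L * N)"
    proof -
      have "\<sigma> * N \<le> \<sigma> * (K * \<sigma>)" using N le nn by (intro mult_left_mono) auto
      then have "\<sigma> * N * (2 * L) \<le> \<sigma> * (K * \<sigma>) * (2 * L)" using LK by (intro mult_right_mono) auto
      then show ?thesis using LK Npos by (simp add: divide_le_eq pos_le_divide_eq mult_ac)
    qed
    moreover have "\<epsilon> / (2 * L * K) \<le> \<sigma> / (2 * L * K)"
      using le LK by (intro divide_right_mono) auto
    ultimately have "\<epsilon>' \<le> (1 - 1 / (2 * L * K)) * \<epsilon>"
      using step by (simp add: left_diff_distrib)
    also have "\<dots> \<le> max (1 - 1 / (2 * L * K)) (1 / 2) * \<epsilon>"
      using nn by (intro mult_right_mono) auto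
    finally show ?thesis .
  qed
qed

section \<open>Policies and real-valued costs\<close>

locale mean_field_game =
  fixes G :: "'a::euclidean_space mfg" and D Lf \<alpha> :: real
    and F :: "nat \<Rightarrow> ('a \<Rightarrow> real) \<Rightarrow> real"
  assumes data: "mfg_data G" and a1: "assumption1 G D Lf \<alpha>"
    and a2: "assumption2 G D" and a3: "assumption3 G F"
begin

abbreviation "T \<equiv> horizon G"
abbreviation "S \<equiv> states G"
abbreviation "dt \<equiv> time_step G"

lemma T_pos: "0 < T" and finite_S: "finite S" and init_prob: "init_dist G \<in> prob_funs S"
  and run_cost_neq_MInf: "t < T \<Longrightarrow> x \<in> S \<Longrightarrow> run_cost G t x \<omega> \<noteq> -\<infinity>"
  using data unfolding mfg_data_def by auto

lemma dt_pos: "0 < dt" and T_dt: "real T * dt = 1"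
  using T_pos by (auto simp: time_step_def)

lemma S_nonempty: "S \<noteq> {}"
  using init_prob by (auto simp: prob_funs_def)

lemma Lf_pos: "0 < Lf" and \<alpha>_pos: "0 < \<alpha>"
  using a1 unfolding assumption1_def by auto

lemma run_cost_lsc: "t < T \<Longrightarrow> x \<in> S \<Longrightarrow> lower_semicont (run_cost G t x)"
  and run_cost_proper: "t < T \<Longrightarrow> x \<in> S \<Longrightarrow> \<exists>\<omega>. run_cost G t x \<omega> \<noteq> \<infinity>"
  and run_cost_outside: "t < T \<Longrightarrow> x \<in> S \<Longrightarrow> norm \<omega> > D \<Longrightarrow> run_cost G t x \<omega> = \<infinity>"
  and run_cost_strongly_convex: "t < T \<Longrightarrow> x \<in> S \<Longrightarrow> strongly_convex \<alpha> (run_cost G t x)"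
  using a1 unfolding assumption1_def by blast+

lemma coupling_lipschitz:
  "t < T \<Longrightarrow> x \<in> S \<Longrightarrow> \<mu> \<in> prob_funs S \<Longrightarrow> \<nu> \<in> prob_funs S \<Longrightarrow>
    \<bar>coupling G t x \<mu> - coupling G t x \<nu>\<bar> \<le> Lf * L2_set (\<lambda>y. \<mu> y - \<nu> y) S"
  and coupling_monotone:
  "t < T \<Longrightarrow> \<mu> \<in> prob_funs S \<Longrightarrow> \<nu> \<in> prob_funs S \<Longrightarrow>
    0 \<le> (\<Sum>x\<in>S. (coupling G t x \<mu> - coupling G t x \<nu>) * (\<mu> x - \<nu> x))"
  using a1 unfolding assumption1_def by blast+

text \<open>
  Membership in the domain of the running cost is required also at states of zero mass, so that
  all costs are finite without a case distinction; the bound \<open>D\<close> on the controls then follows.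
\<close>
definition policy :: "(nat \<Rightarrow> 'a \<Rightarrow> 'a) \<Rightarrow> bool" where
  "policy v \<longleftrightarrow> v \<in> funs_on {..<T} S \<and> (\<forall>t<T. \<forall>x\<in>S. run_cost G t x (v t x) \<noteq> \<infinity>)"

definition real_cost :: "nat \<Rightarrow> 'a \<Rightarrow> 'a \<Rightarrow> real" where
  "real_cost t x \<omega> = real_of_ereal (run_cost G t x \<omega>)"

definition frozen_value :: "(nat \<Rightarrow> 'a \<Rightarrow> real) \<Rightarrow> (nat \<Rightarrow> 'a \<Rightarrow> 'a) \<Rightarrow> real" where
  "frozen_value m' v =
    dt * (\<Sum>t<T. \<Sum>x\<in>S. (real_cost t x (v t x) + coupling G t x (m' t)) * FP G v t x)
    + (\<Sum>x\<in>S. final_cost G x * FP G v T x)"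

definition total_value :: "(nat \<Rightarrow> 'a \<Rightarrow> 'a) \<Rightarrow> real" where
  "total_value v =
    dt * (\<Sum>t<T. \<Sum>x\<in>S. real_cost t x (v t x) * FP G v t x)
    + dt * (\<Sum>t<T. F t (FP G v t))
    + (\<Sum>x\<in>S. final_cost G x * FP G v T x)"

definition best_response :: "(nat \<Rightarrow> 'a \<Rightarrow> real) \<Rightarrow> nat \<Rightarrow> 'a \<Rightarrow> 'a" where
  "best_response m = V G (HJB G m)"

lemma BR_eq: "BR G m = (FP G (best_response m), flux (FP G (best_response m)) (best_response m))"
  by (simp add: BR_def best_response_def Let_def)

lemma run_cost_eq:
  "t < T \<Longrightarrow> x \<in> S \<Longrightarrow> run_cost G t x \<omega> \<noteq> \<infinity> \<Longrightarrow> run_cost G t x \<omega> = ereal (real_cost t x \<omega>)"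
  using run_cost_neq_MInf[of t x \<omega>] by (cases "run_cost G t x \<omega>") (auto simp: real_cost_def)

lemma policy_norm_le: "policy v \<Longrightarrow> t < T \<Longrightarrow> x \<in> S \<Longrightarrow> norm (v t x) \<le> D"
  using run_cost_outside[of t x "v t x"] unfolding policy_def by (metis not_le)

lemma policy_norm_inf_inf: "policy v \<Longrightarrow> norm_inf_inf {..<T} S v \<le> D"
  unfolding norm_inf_inf_def
  using T_pos finite_S S_nonempty policy_norm_le by (auto simp: Max_le_iff lessThan_empty_iff)

lemma norm_inf_inf_leD:
  assumes "norm_inf_inf {..<T} S v \<le> D" "t < T" "x \<in> S"
  shows "norm (v t x) \<le> D"
proof -
  have "norm (v t x) \<le> (MAX x\<in>S. norm (v t x))" using assms finite_S by (intro Max_ge) auto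
  also have "\<dots> \<le> norm_inf_inf {..<T} S v"
    unfolding norm_inf_inf_def using assms by (intro Max_ge) auto
  finally show ?thesis using assms by simp
qed

section \<open>The controlled Markov chain\<close>

text \<open>
  The drift part of the kernel is dominated by \<^const>\<open>kernel0\<close> as long as the control does not
  exceed \<open>D\<close>.
\<close>
lemma transition_nonneg:
  assumes "t < T" "x \<in> S" "y \<in> S" "norm \<omega> \<le> D"
  shows "0 \<le> transition G t x y \<omega>"
proof -
  have "- (kernel1 G t x y \<bullet> \<omega>) \<le> norm (kernel1 G t x y) * norm \<omega>"
    using Cauchy_Schwarz_ineq2[of "kernel1 G t x y" \<omega>] by linarith
  also have "\<dots> \<le> norm (kernel1 G t x y) * D" using assms by (intro mult_left_mono) auto
  finally have "dt * - (kernel1 G t x y \<bullet> \<omega>) \<le> dt * (norm (kernel1 G t x y) * D)"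
    using dt_pos by (intro mult_left_mono) auto
  moreover have "dt * D * norm (kernel1 G t x y) \<le> kernel0 G t x y"
    using a2 assms unfolding assumption2_def by blast
  ultimately show ?thesis by (simp add: transition_def algebra_simps)
qed

lemma transition_sum:
  assumes "t < T" "x \<in> S"
  shows "(\<Sum>y\<in>S. transition G t x y \<omega>) = 1"
proof -
  have "(\<Sum>y\<in>S. transition G t x y \<omega>)
      = (\<Sum>y\<in>S. kernel0 G t x y) + dt * ((\<Sum>y\<in>S. kernel1 G t x y) \<bullet> \<omega>)"
    by (simp add: transition_def sum.distrib sum_distrib_left inner_sum_left)
  also have "\<dots> = 1" using a2 assms by (simp add: assumption2_def prob_funs_def)
  finally show ?thesis .
qed

lemma FP_prob_funs:
  assumes "\<And>t x. t < T \<Longrightarrow> x \<in> S \<Longrightarrow> norm (v t x) \<le> D" and "t \<le> T"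
  shows "FP G v t \<in> prob_funs S"
  using assms(2)
proof (induction t)
  case 0
  then show ?case using init_prob by simp
next
  case (Suc t)
  then have t: "t < T" and IH: "FP G v t \<in> prob_funs S" by auto
  have "(\<Sum>y\<in>S. \<Sum>x\<in>S. transition G t x y (v t x) * FP G v t x)
      = (\<Sum>x\<in>S. \<Sum>y\<in>S. transition G t x y (v t x) * FP G v t x)"
    by (rule sum.swap)
  also have "\<dots> = (\<Sum>x\<in>S. FP G v t x)"
    by (simp add: sum_distrib_right[symmetric] transition_sum[OF t])
  finally have "(\<Sum>y\<in>S. \<Sum>x\<in>S. transition G t x y (v t x) * FP G v t x) = 1"
    using IH by (simp add: prob_funs_def)
  then show ?case
    using t assms(1) IH transition_nonneg[OF t]
    by (auto simp: prob_funs_def intro!: sum_nonneg mult_nonneg_nonneg)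
qed

lemma FP_prob_paths:
  assumes "\<And>t x. t < T \<Longrightarrow> x \<in> S \<Longrightarrow> norm (v t x) \<le> D"
  shows "FP G v \<in> prob_paths G"
proof -
  have "FP G v t x = 0" if "\<not> (t \<in> {..T} \<and> x \<in> S)" for t x
    using that init_prob by (cases t) (auto simp: prob_funs_def)
  then show ?thesis
    using FP_prob_funs[OF assms] by (auto simp: prob_paths_def funs_on_def)
qed

lemma policy_FP_prob_paths: "policy v \<Longrightarrow> FP G v \<in> prob_paths G"
  by (rule FP_prob_paths) (rule policy_norm_le)

lemma prob_paths_prob_funs: "m \<in> prob_paths G \<Longrightarrow> t \<le> T \<Longrightarrow> m t \<in> prob_funs S"
  by (simp add: prob_paths_def)

lemma policy_FP_nonneg: "policy v \<Longrightarrow> t \<le> T \<Longrightarrow> 0 \<le> FP G v t x"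
  using prob_funs_nonneg[OF prob_paths_prob_funs[OF policy_FP_prob_paths]] .

lemma policy_admissible: "policy v \<Longrightarrow> (FP G v, v) \<in> admissible G D"
  unfolding admissible_def
  using policy_FP_prob_paths policy_norm_inf_inf by (auto simp: policy_def)

section \<open>Dynamic programming and quadratic growth\<close>

text \<open>
  The expected continuation value is affine in the control; hence the one-step problem tilts the
  running cost by a linear form.
\<close>
lemma transition_affine:
  "(\<Sum>y\<in>S. transition G t x y \<omega> * q y)
    = (\<Sum>y\<in>S. kernel0 G t x y * q y) + (dt *\<^sub>R (\<Sum>y\<in>S. q y *\<^sub>R kernel1 G t x y)) \<bullet> \<omega>"
  by (simp add: transition_def sum.distrib sum_distrib_left inner_sum_left algebra_simps)

lemma V_minimizes:
  assumes "t < T" "x \<in> S"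
  shows "run_cost G t x (V G u t x) \<noteq> \<infinity>"
    and "run_cost G t x (V G u t x) * ereal dt + ereal (\<Sum>y\<in>S. transition G t x y (V G u t x) * u (Suc t) y)
      \<le> run_cost G t x \<omega> * ereal dt + ereal (\<Sum>y\<in>S. transition G t x y \<omega> * u (Suc t) y)"
proof -
  define q where "q \<omega> = (\<Sum>y\<in>S. transition G t x y \<omega> * u (Suc t) y)" for \<omega>
  define cost where "cost \<omega> = run_cost G t x \<omega> * ereal dt + ereal (q \<omega>)" for \<omega>
  obtain a where a: "run_cost G t x a \<noteq> \<infinity>" using run_cost_proper[OF assms] by blast
  have "continuous_on UNIV (\<lambda>\<omega>. q \<omega> / dt)"
    unfolding q_def transition_affine using dt_pos by (intro continuous_intros) auto
  then obtain w where w: "run_cost G t x w \<noteq> \<infinity>"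
    "\<And>\<omega>. run_cost G t x w + ereal (q w / dt) \<le> run_cost G t x \<omega> + ereal (q \<omega> / dt)"
    using lower_semicont_perturbed_minimizer[OF run_cost_lsc[OF assms] run_cost_outside[OF assms]
      _ a] by blast
  have "cost w \<le> cost \<omega>" for \<omega>
  proof (cases "run_cost G t x \<omega> = \<infinity>")
    case False
    then have "real_cost t x w + q w / dt \<le> real_cost t x \<omega> + q \<omega> / dt"
      using w(2)[of \<omega>] by (simp add: run_cost_eq[OF assms False] run_cost_eq[OF assms w(1)])
    then have "(real_cost t x w + q w / dt) * dt \<le> (real_cost t x \<omega> + q \<omega> / dt) * dt"
      using dt_pos by (intro mult_right_mono) auto
    then have "real_cost t x w * dt + q w \<le> real_cost t x \<omega> * dt + q \<omega>"
      using dt_pos by (simp add: distrib_right)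
    then show ?thesis by (simp add: run_cost_eq[OF assms False] run_cost_eq[OF assms w(1)] cost_def)
  qed (use dt_pos in \<open>simp add: cost_def\<close>)
  then have "is_arg_min cost (\<lambda>_. True) w" by (simp add: is_arg_min_linorder)
  then have "is_arg_min cost (\<lambda>_. True) (V G u t x)"
    using assms someI[of "is_arg_min cost (\<lambda>_. True)" w]
    by (simp add: V_def arg_min_def cost_def[abs_def] q_def)
  then have *: "cost (V G u t x) \<le> cost \<omega>" for \<omega> by (simp add: is_arg_min_linorder)
  show "run_cost G t x (V G u t x) \<noteq> \<infinity>"
    using *[of a] a run_cost_eq[OF assms a] dt_pos by (auto simp: cost_def)
  show "run_cost G t x (V G u t x) * ereal dt + ereal (\<Sum>y\<in>S. transition G t x y (V G u t x) * u (Suc t) y)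
      \<le> run_cost G t x \<omega> * ereal dt + ereal (\<Sum>y\<in>S. transition G t x y \<omega> * u (Suc t) y)"
    using *[of \<omega>] by (simp add: cost_def q_def)
qed

text \<open>
  The slope of the affine continuation value yields a subgradient of the running cost at the
  optimal control, and strong convexity at that subgradient is quadratic growth of the
  one-step problem.
\<close>
lemma V_growth:
  assumes "t < T" "x \<in> S" and fin: "run_cost G t x \<omega> \<noteq> \<infinity>"
  shows "real_cost t x (V G u t x) * dt + (\<Sum>y\<in>S. transition G t x y (V G u t x) * u (Suc t) y)
      + \<alpha> / 2 * dt * (norm (\<omega> - V G u t x))\<^sup>2
    \<le> real_cost t x \<omega> * dt + (\<Sum>y\<in>S. transition G t x y \<omega> * u (Suc t) y)"
proof -
  let ?v = "V G u t x"
  define b where "b = (\<Sum>y\<in>S. kernel0 G t x y * u (Suc t) y)"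
  define p where "p = dt *\<^sub>R (\<Sum>y\<in>S. u (Suc t) y *\<^sub>R kernel1 G t x y)"
  have aff: "(\<Sum>y\<in>S. transition G t x y \<omega> * u (Suc t) y) = b + p \<bullet> \<omega>" for \<omega>
    by (simp only: transition_affine b_def p_def)
  have "is_subgradient (run_cost G t x) ?v (- (p /\<^sub>R dt))"
  proof (rule minimizer_imp_subgradient[where b = b])
    show "run_cost G t x ?v * ereal dt + ereal (b + p \<bullet> ?v)
        \<le> run_cost G t x v' * ereal dt + ereal (b + p \<bullet> v')" for v'
      using V_minimizes(2)[OF assms(1,2), of u v'] by (simp only: aff)
  qed (use V_minimizes(1)[OF assms(1,2)] run_cost_neq_MInf[OF assms(1,2)] dt_pos in auto)
  from strongly_convex_growth[OF run_cost_neq_MInf[OF assms(1,2)]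
      run_cost_strongly_convex[OF assms(1,2)] this V_minimizes(1)[OF assms(1,2)] fin]
  have "(real_cost t x ?v + - (p /\<^sub>R dt) \<bullet> (\<omega> - ?v) + \<alpha> / 2 * (norm (\<omega> - ?v))\<^sup>2) * dt
      \<le> real_cost t x \<omega> * dt"
    using dt_pos by (intro mult_right_mono) (auto simp: real_cost_def)
  moreover have "(- (p /\<^sub>R dt) \<bullet> (\<omega> - ?v)) * dt = - (p \<bullet> (\<omega> - ?v))"
    using dt_pos by simp
  ultimately show ?thesis
    unfolding aff by (simp add: algebra_simps inner_diff_right)
qed

lemma best_response_policy: "policy (best_response m)"
  unfolding policy_def best_response_def using V_minimizes(1) by (auto simp: funs_on_def V_def)

text \<open>
  The excess in the dynamic programming equation when the control \<open>\<omega>\<close> is used instead of the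
  optimal one.
\<close>
definition bellman_gap :: "(nat \<Rightarrow> 'a \<Rightarrow> real) \<Rightarrow> nat \<Rightarrow> 'a \<Rightarrow> 'a \<Rightarrow> real" where
  "bellman_gap m t x \<omega> = (real_cost t x \<omega> + coupling G t x (m t)) * dt
    + (\<Sum>y\<in>S. transition G t x y \<omega> * HJB G m (Suc t) y) - HJB G m t x"

lemma bellman_gap_best_response:
  assumes "t < T" "x \<in> S"
  shows "bellman_gap m t x (best_response m t x) = 0"
proof -
  let ?v = "best_response m t x" and ?c = "coupling G t x (m t)"
  define q where "q \<omega> = (\<Sum>y\<in>S. transition G t x y \<omega> * HJB G m (Suc t) y)" for \<omega>
  have fin: "run_cost G t x ?v \<noteq> \<infinity>" using best_response_policy assms by (auto simp: policy_def)
  have "(INF \<omega>. (run_cost G t x \<omega> + ereal ?c) * ereal dt + ereal (q \<omega>))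
      = ereal ((real_cost t x ?v + ?c) * dt + q ?v)"
  proof (rule INF_eqI)
    fix \<omega>
    show "ereal ((real_cost t x ?v + ?c) * dt + q ?v)
      \<le> (run_cost G t x \<omega> + ereal ?c) * ereal dt + ereal (q \<omega>)"
    proof (cases "run_cost G t x \<omega> = \<infinity>")
      case False
      have "0 \<le> \<alpha> / 2 * dt * (norm (\<omega> - ?v))\<^sup>2" using \<alpha>_pos dt_pos by simp
      then have "real_cost t x ?v * dt + q ?v \<le> real_cost t x \<omega> * dt + q \<omega>"
        using V_growth[OF assms False, of "HJB G m"] by (simp add: best_response_def q_def)
      then show ?thesis using run_cost_eq[OF assms False] by (simp add: algebra_simps)
    qed (use dt_pos in simp)
  next
    fix z assume "\<And>\<omega>. \<omega> \<in> UNIV \<Longrightarrow> z \<le> (run_cost G t x \<omega> + ereal ?c) * ereal dt + ereal (q \<omega>)"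
    from this[of ?v] show "z \<le> ereal ((real_cost t x ?v + ?c) * dt + q ?v)"
      using run_cost_eq[OF assms fin] by simp
  qed
  then have "HJB G m t x = (real_cost t x ?v + ?c) * dt + q ?v"
    using assms by (subst HJB.simps) (simp add: q_def)
  then show ?thesis by (simp add: bellman_gap_def q_def)
qed

lemma bellman_gap_growth:
  assumes "t < T" "x \<in> S" "run_cost G t x \<omega> \<noteq> \<infinity>"
  shows "\<alpha> / 2 * dt * (norm (\<omega> - best_response m t x))\<^sup>2 \<le> bellman_gap m t x \<omega>"
  using V_growth[OF assms, of "HJB G m"] bellman_gap_best_response[OF assms(1,2), of m]
  by (simp add: bellman_gap_def best_response_def algebra_simps)

text \<open>
  The mass-weighted value function \<open>\<Sum>x. FP v t x * HJB m t x\<close> telescopes in time, because \<^const>\<open>FP\<close> is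
  driven by the transpose of the transition operator in \<^const>\<open>HJB\<close>. The first sum is the
  same for all controls, so only the Bellman gaps distinguish them.
\<close>
lemma frozen_value_eq_gaps:
  "frozen_value m v = (\<Sum>x\<in>S. FP G v 0 x * HJB G m 0 x)
    + (\<Sum>t<T. \<Sum>x\<in>S. FP G v t x * bellman_gap m t x (v t x))"
proof -
  define W where "W t = (\<Sum>x\<in>S. FP G v t x * HJB G m t x)" for t
  have "(\<Sum>x\<in>S. FP G v t x * bellman_gap m t x (v t x))
      = dt * (\<Sum>x\<in>S. (real_cost t x (v t x) + coupling G t x (m t)) * FP G v t x) + (W (Suc t) - W t)"
    if t: "t < T" for t
  proof -
    have "(\<Sum>x\<in>S. FP G v t x * (\<Sum>y\<in>S. transition G t x y (v t x) * HJB G m (Suc t) y))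
        = (\<Sum>x\<in>S. \<Sum>y\<in>S. transition G t x y (v t x) * FP G v t x * HJB G m (Suc t) y)"
      by (simp add: sum_distrib_left mult_ac)
    also have "\<dots> = (\<Sum>y\<in>S. \<Sum>x\<in>S. transition G t x y (v t x) * FP G v t x * HJB G m (Suc t) y)"
      by (rule sum.swap)
    also have "\<dots> = W (Suc t)"
      using t by (simp add: W_def sum_distrib_right)
    finally show ?thesis
      by (simp add: bellman_gap_def W_def sum.distrib sum_subtractf sum_distrib_left algebra_simps)
  qed
  then have "(\<Sum>t<T. \<Sum>x\<in>S. FP G v t x * bellman_gap m t x (v t x))
      = dt * (\<Sum>t<T. \<Sum>x\<in>S. (real_cost t x (v t x) + coupling G t x (m t)) * FP G v t x)
        + (W T - W 0)"
    by (simp add: sum.distrib sum_distrib_left sum_lessThan_telescope)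
  moreover have "W T = (\<Sum>x\<in>S. final_cost G x * FP G v T x)"
    unfolding W_def by (intro sum.cong refl) (subst HJB.simps, simp)
  ultimately show ?thesis by (simp add: frozen_value_def W_def)
qed

lemma frozen_value_growth:
  assumes v: "policy v"
  shows "frozen_value m (best_response m)
      + \<alpha> / 2 * dt * (\<Sum>t<T. \<Sum>x\<in>S. FP G v t x * (norm (v t x - best_response m t x))\<^sup>2) \<le> frozen_value m v"
proof -
  have "\<alpha> / 2 * dt * (\<Sum>t<T. \<Sum>x\<in>S. FP G v t x * (norm (v t x - best_response m t x))\<^sup>2)
      = (\<Sum>t<T. \<Sum>x\<in>S. FP G v t x * (\<alpha> / 2 * dt * (norm (v t x - best_response m t x))\<^sup>2))"
    by (simp add: sum_distrib_left mult_ac)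
  also have "\<dots> \<le> (\<Sum>t<T. \<Sum>x\<in>S. FP G v t x * bellman_gap m t x (v t x))"
    using v policy_FP_nonneg[OF v]
    by (intro sum_mono mult_left_mono bellman_gap_growth) (auto simp: policy_def)
  finally show ?thesis
    by (simp add: frozen_value_eq_gaps bellman_gap_best_response)
qed

lemma frozen_value_best_response_le:
  assumes "policy v"
  shows "frozen_value m (best_response m) \<le> frozen_value m v"
proof -
  have "0 \<le> \<alpha> / 2 * dt * (\<Sum>t<T. \<Sum>x\<in>S. FP G v t x * (norm (v t x - best_response m t x))\<^sup>2)"
    using \<alpha>_pos dt_pos policy_FP_nonneg[OF assms]
    by (intro mult_nonneg_nonneg sum_nonneg) auto
  then show ?thesis using frozen_value_growth[OF assms, of m] by linarith
qed

section \<open>Agreement with the extended-real costs\<close>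

lemma run_cost_flux_policy:
  assumes "policy v" "t < T" "x \<in> S"
  shows "run_cost_flux G (FP G v) (flux (FP G v) v) t x = ereal (real_cost t x (v t x) * FP G v t x)"
  using assms run_cost_eq[OF assms(2,3), of "v t x"]
  by (auto simp: run_cost_flux_def flux_def policy_def)

lemma total_cost_policy:
  assumes "policy v"
  shows "total_cost G F (FP G v) (flux (FP G v) v) = ereal (total_value v)"
proof -
  have "(\<Sum>t<T. \<Sum>x\<in>S. run_cost_flux G (FP G v) (flux (FP G v) v) t x)
      = ereal (\<Sum>t<T. \<Sum>x\<in>S. real_cost t x (v t x) * FP G v t x)"
    by (simp add: run_cost_flux_policy[OF assms] sum_ereal)
  then show ?thesis by (simp add: total_cost_def total_value_def)
qed

lemma frozen_cost_policy:
  assumes "policy v"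
  shows "frozen_cost G m (FP G v) (flux (FP G v) v) = ereal (frozen_value m v)"
proof -
  have "(\<Sum>t<T. \<Sum>x\<in>S. run_cost_flux G (FP G v) (flux (FP G v) v) t x
        + ereal (coupling G t x (m t) * FP G v t x))
      = ereal (\<Sum>t<T. \<Sum>x\<in>S. (real_cost t x (v t x) + coupling G t x (m t)) * FP G v t x)"
    by (simp add: run_cost_flux_policy[OF assms] sum_ereal algebra_simps)
  then show ?thesis by (simp add: frozen_cost_def frozen_value_def)
qed

section \<open>Convex combinations of distributions and fluxes\<close>

lemma run_cost_convex:
  assumes tx: "t < T" "x \<in> S" and a: "run_cost G t x a \<noteq> \<infinity>" and b: "run_cost G t x b \<noteq> \<infinity>"
    and s: "0 \<le> s" "s \<le> 1"
  shows "run_cost G t x ((1 - s) *\<^sub>R a + s *\<^sub>R b) \<noteq> \<infinity>"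
    and "real_cost t x ((1 - s) *\<^sub>R a + s *\<^sub>R b) \<le> (1 - s) * real_cost t x a + s * real_cost t x b"
proof -
  have le: "run_cost G t x ((1 - s) *\<^sub>R a + s *\<^sub>R b)
      \<le> ereal ((1 - s) * real_cost t x a + s * real_cost t x b)"
    unfolding real_cost_def
    by (rule strongly_convex_imp_convex[OF run_cost_lsc[OF tx] run_cost_outside[OF tx]
      run_cost_neq_MInf[OF tx] run_cost_strongly_convex[OF tx] \<alpha>_pos a b s])
  then show fin: "run_cost G t x ((1 - s) *\<^sub>R a + s *\<^sub>R b) \<noteq> \<infinity>" by auto
  show "real_cost t x ((1 - s) *\<^sub>R a + s *\<^sub>R b) \<le> (1 - s) * real_cost t x a + s * real_cost t x b"
    using le by (simp add: run_cost_eq[OF tx fin])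
qed

text \<open>
  A convex combination of two (distribution, flux) pairs is generated by the control that averages
  the two controls with the weights \<open>(1 - s) m(t,x)\<close> and \<open>s m'(t,x)\<close> of mass that they bring to
  \<open>(t,x)\<close>. The last property is convexity of the perspective of the running cost.
\<close>
lemma policy_mixture:
  assumes v: "policy v" and v': "policy v'" and s: "0 \<le> s" "s \<le> 1"
  obtains z where "policy z"
    "FP G z = (\<lambda>t x. (1 - s) * FP G v t x + s * FP G v' t x)"
    "flux (FP G z) z = (\<lambda>t x. (1 - s) *\<^sub>R flux (FP G v) v t x + s *\<^sub>R flux (FP G v') v' t x)"
    "\<And>t x. t < T \<Longrightarrow> x \<in> S \<Longrightarrow> real_cost t x (z t x) * FP G z t x
      \<le> (1 - s) * (real_cost t x (v t x) * FP G v t x) + s * (real_cost t x (v' t x) * FP G v' t x)"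
proof -
  define \<mu> where "\<mu> t x = (1 - s) * FP G v t x + s * FP G v' t x" for t x
  \<comment> \<open>The share of the mass that is due to \<open>v'\<close>. Without mass it is \<open>0\<close> (division by zero),
     and \<open>z\<close> is \<open>v\<close>, a point of the domain.\<close>
  define \<theta> where "\<theta> t x = s * FP G v' t x / \<mu> t x" for t x
  define z where "z t x = (1 - \<theta> t x) *\<^sub>R v t x + \<theta> t x *\<^sub>R v' t x" for t x
  have nn: "0 \<le> (1 - s) * FP G v t x" "0 \<le> s * FP G v' t x" if "t \<le> T" for t x
    using s policy_FP_nonneg[OF v that] policy_FP_nonneg[OF v' that] by auto
  have \<theta>01: "0 \<le> \<theta> t x" "\<theta> t x \<le> 1" if "t \<le> T" for t x
    using nn[OF that, of x] by (auto simp: \<theta>_def \<mu>_def divide_le_eq_1)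
  have w2: "\<mu> t x * \<theta> t x = s * FP G v' t x" if "t \<le> T" for t x
  proof (cases "\<mu> t x = 0")
    case True
    then have "s * FP G v' t x = 0" using nn[OF that, of x] unfolding \<mu>_def by linarith
    then show ?thesis using True by simp
  qed (simp add: \<theta>_def)
  have w1: "\<mu> t x * (1 - \<theta> t x) = (1 - s) * FP G v t x" if "t \<le> T" for t x
    using w2[OF that, of x] by (simp add: right_diff_distrib \<mu>_def)
  have off: "v t x = 0" "v' t x = 0" if "\<not> (t < T \<and> x \<in> S)" for t x
    using v v' that by (auto simp: policy_def funs_on_def)
  have zconv: "run_cost G t x (z t x) \<noteq> \<infinity>"
    "real_cost t x (z t x) \<le> (1 - \<theta> t x) * real_cost t x (v t x) + \<theta> t x * real_cost t x (v' t x)"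
    if "t < T" "x \<in> S" for t x
    unfolding z_def using run_cost_convex[OF that _ _ \<theta>01] v v' that
    by (auto simp: policy_def)
  have z: "policy z"
    using zconv(1) by (auto simp: policy_def funs_on_def z_def off)
  \<comment> \<open>Although \<open>z\<close> depends nonlinearly on the data, its flux is the convex combination of the fluxes;
     the dynamics see only the flux.\<close>
  have flux_z: "\<mu> t x *\<^sub>R z t x = (1 - s) *\<^sub>R FP G v t x *\<^sub>R v t x + s *\<^sub>R FP G v' t x *\<^sub>R v' t x"
    if "t \<le> T" for t x
  proof -
    have "\<mu> t x *\<^sub>R z t x = (\<mu> t x * (1 - \<theta> t x)) *\<^sub>R v t x + (\<mu> t x * \<theta> t x) *\<^sub>R v' t x"
      by (simp add: z_def scaleR_add_right)
    then show ?thesis by (simp add: w1[OF that] w2[OF that])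
  qed
  have FPz: "FP G z t = \<mu> t" for t
  proof (induction t)
    case 0
    then show ?case by (simp add: \<mu>_def fun_eq_iff algebra_simps)
  next
    case (Suc t)
    have "transition G t x y (z t x) * \<mu> t x = (1 - s) * (transition G t x y (v t x) * FP G v t x)
        + s * (transition G t x y (v' t x) * FP G v' t x)" if "t < T" for x y
    proof -
      have "kernel1 G t x y \<bullet> (\<mu> t x *\<^sub>R z t x)
          = (1 - s) * FP G v t x * (kernel1 G t x y \<bullet> v t x)
            + s * FP G v' t x * (kernel1 G t x y \<bullet> v' t x)"
        using flux_z[of t x] that by (simp add: inner_add_right)
      then have *: "\<mu> t x * (kernel1 G t x y \<bullet> z t x)
          = (1 - s) * FP G v t x * (kernel1 G t x y \<bullet> v t x)
            + s * FP G v' t x * (kernel1 G t x y \<bullet> v' t x)" by simp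
      have "transition G t x y (z t x) * \<mu> t x
          = kernel0 G t x y * \<mu> t x + dt * (\<mu> t x * (kernel1 G t x y \<bullet> z t x))"
        by (simp add: transition_def algebra_simps)
      then show ?thesis unfolding * by (simp add: transition_def \<mu>_def algebra_simps)
    qed
    then show ?case
      using Suc by (auto simp: fun_eq_iff \<mu>_def[of "Suc t"] sum.distrib sum_distrib_left)
  qed
  show thesis
  proof (rule that[OF z])
    show "FP G z = (\<lambda>t x. (1 - s) * FP G v t x + s * FP G v' t x)"
      by (simp add: fun_eq_iff FPz \<mu>_def)
    show "flux (FP G z) z = (\<lambda>t x. (1 - s) *\<^sub>R flux (FP G v) v t x + s *\<^sub>R flux (FP G v') v' t x)"
    proof (intro ext)
      fix t x
      show "flux (FP G z) z t x = (1 - s) *\<^sub>R flux (FP G v) v t x + s *\<^sub>R flux (FP G v') v' t x"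
      proof (cases "t < T \<and> x \<in> S")
        case True
        then show ?thesis using flux_z[of t x] by (simp add: flux_def FPz)
      next
        case False
        then show ?thesis using off[OF False] by (simp add: flux_def z_def)
      qed
    qed
  next
    fix t x assume tx: "t < T" "x \<in> S"
    then have t: "t \<le> T" by simp
    have "0 \<le> \<mu> t x" using nn[OF t, of x] by (simp add: \<mu>_def)
    then have "\<mu> t x * real_cost t x (z t x)
        \<le> \<mu> t x * ((1 - \<theta> t x) * real_cost t x (v t x) + \<theta> t x * real_cost t x (v' t x))"
      using zconv(2)[OF tx] by (intro mult_left_mono)
    also have "\<dots> = (\<mu> t x * (1 - \<theta> t x)) * real_cost t x (v t x) + (\<mu> t x * \<theta> t x) * real_cost t x (v' t x)"
      by (simp add: algebra_simps)
    also have "\<dots> = (1 - s) * (real_cost t x (v t x) * FP G v t x) + s * (real_cost t x (v' t x) * FP G v' t x)"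
      by (simp add: w1[OF t] w2[OF t])
    finally show "real_cost t x (z t x) * FP G z t x
      \<le> (1 - s) * (real_cost t x (v t x) * FP G v t x) + s * (real_cost t x (v' t x) * FP G v' t x)"
      by (simp add: FPz mult.commute)
  qed
qed

lemma frozen_value_mixture:
  assumes FPz: "FP G z = (\<lambda>t x. (1 - s) * FP G v t x + s * FP G v' t x)"
    and cost: "\<And>t x. t < T \<Longrightarrow> x \<in> S \<Longrightarrow> real_cost t x (z t x) * FP G z t x
      \<le> (1 - s) * (real_cost t x (v t x) * FP G v t x) + s * (real_cost t x (v' t x) * FP G v' t x)"
  shows "frozen_value m z \<le> (1 - s) * frozen_value m v + s * frozen_value m v'"
proof -
  let ?K = "\<lambda>v. (\<Sum>t<T. \<Sum>x\<in>S. (real_cost t x (v t x) + coupling G t x (m t)) * FP G v t x)"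
  let ?g = "\<lambda>v. (\<Sum>x\<in>S. final_cost G x * FP G v T x)"
  have "?K z \<le> (\<Sum>t<T. \<Sum>x\<in>S. (1 - s) * ((real_cost t x (v t x) + coupling G t x (m t)) * FP G v t x)
      + s * ((real_cost t x (v' t x) + coupling G t x (m t)) * FP G v' t x))"
  proof (intro sum_mono)
    fix t x assume "t \<in> {..<T}" "x \<in> S"
    then show "(real_cost t x (z t x) + coupling G t x (m t)) * FP G z t x
      \<le> (1 - s) * ((real_cost t x (v t x) + coupling G t x (m t)) * FP G v t x)
        + s * ((real_cost t x (v' t x) + coupling G t x (m t)) * FP G v' t x)"
      using cost[of t x] by (simp add: FPz algebra_simps)
  qed
  also have "\<dots> = (1 - s) * ?K v + s * ?K v'"
    by (simp add: sum.distrib sum_distrib_left)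
  finally have "dt * ?K z \<le> dt * ((1 - s) * ?K v + s * ?K v')"
    using dt_pos by (intro mult_left_mono) auto
  moreover have "?g z = (1 - s) * ?g v + s * ?g v'"
    by (simp add: FPz sum.distrib[symmetric] sum_distrib_left algebra_simps)
  ultimately show ?thesis
    unfolding frozen_value_def by (simp add: algebra_simps)
qed

section \<open>The potential and its linearisation\<close>

lemma coupling_diff_bound:
  assumes t: "t < T" and p: "\<mu> \<in> prob_funs S" "\<nu> \<in> prob_funs S"
  shows "(\<Sum>x\<in>S. (coupling G t x \<mu> - coupling G t x \<nu>) * d x)
    \<le> Lf * sqrt (real (card S)) * L2_set (\<lambda>y. \<mu> y - \<nu> y) S * L2_set d S"
proof -
  let ?N = "L2_set (\<lambda>y. \<mu> y - \<nu> y) S"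
  have "(\<Sum>x\<in>S. (coupling G t x \<mu> - coupling G t x \<nu>) * d x) \<le> (\<Sum>x\<in>S. Lf * ?N * \<bar>d x\<bar>)"
  proof (rule sum_mono)
    fix x assume x: "x \<in> S"
    have "(coupling G t x \<mu> - coupling G t x \<nu>) * d x
        \<le> \<bar>coupling G t x \<mu> - coupling G t x \<nu>\<bar> * \<bar>d x\<bar>"
      by (metis abs_ge_self abs_mult)
    also have "\<dots> \<le> Lf * ?N * \<bar>d x\<bar>"
      using coupling_lipschitz[OF t x p] by (intro mult_right_mono) auto
    finally show "(coupling G t x \<mu> - coupling G t x \<nu>) * d x \<le> Lf * ?N * \<bar>d x\<bar>" .
  qed
  also have "\<dots> = Lf * ?N * (\<Sum>x\<in>S. \<bar>1\<bar> * \<bar>d x\<bar>)" by (simp add: sum_distrib_left)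
  also have "\<dots> \<le> Lf * ?N * (L2_set (\<lambda>_. 1) S * L2_set d S)"
    using Lf_pos by (intro mult_left_mono L2_set_mult_ineq mult_nonneg_nonneg L2_set_nonneg) auto
  also have "\<dots> = Lf * sqrt (real (card S)) * ?N * L2_set d S"
    by (simp add: L2_set_def)
  finally show ?thesis .
qed

text \<open>
  Along the segment from \<open>\<mu>\<close> to \<open>\<nu>\<close> let \<open>\<phi>\<close> be the derivative of the potential.
  Monotonicity of the coupling gives \<open>\<phi> 0 \<le> \<phi> s\<close>, Lipschitz continuity gives
  \<open>\<phi> s \<le> \<phi> 0 + s K\<close>; integration over the segment yields the two bounds.
\<close>
lemma potential_bounds:
  assumes t: "t < T" and p: "\<mu> \<in> prob_funs S" "\<nu> \<in> prob_funs S"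
  shows "(\<Sum>x\<in>S. coupling G t x \<mu> * (\<nu> x - \<mu> x)) \<le> F t \<nu> - F t \<mu>"
    and "F t \<nu> - F t \<mu> \<le> (\<Sum>x\<in>S. coupling G t x \<mu> * (\<nu> x - \<mu> x))
      + Lf * sqrt (real (card S)) / 2 * (L2_set (\<lambda>x. \<nu> x - \<mu> x) S)\<^sup>2"
proof -
  define \<gamma> where "\<gamma> s = (\<lambda>y. \<mu> y + s * (\<nu> y - \<mu> y))" for s :: real
  define N where "N = L2_set (\<lambda>x. \<nu> x - \<mu> x) S"
  define \<phi> where "\<phi> s = (\<Sum>x\<in>S. coupling G t x (\<gamma> s) * (\<nu> x - \<mu> x))" for s
  define K where "K = Lf * sqrt (real (card S)) * N\<^sup>2"
  have \<gamma>: "\<gamma> s \<in> prob_funs S" if "s \<in> {0..1}" for s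
    unfolding \<gamma>_def using that by (intro prob_funs_convex p) auto
  have \<gamma>0: "\<gamma> 0 = \<mu>" by (simp add: \<gamma>_def)
  have \<gamma>N: "L2_set (\<lambda>y. \<gamma> s y - \<gamma> s' y) S = \<bar>s - s'\<bar> * N" for s s'
  proof -
    have "L2_set (\<lambda>y. \<gamma> s y - \<gamma> s' y) S = L2_set (\<lambda>y. \<bar>s - s'\<bar> * (\<nu> y - \<mu> y)) S"
      unfolding L2_set_def by (simp add: \<gamma>_def left_diff_distrib[symmetric] power_mult_distrib)
    then show ?thesis by (simp add: L2_set_right_distrib N_def)
  qed
  have cont_c: "continuous_on {0..1} (\<lambda>s. coupling G t x (\<gamma> s))" if x: "x \<in> S" for x
  proof (rule lipschitz_on_continuous_on)
    show "(Lf * N)-lipschitz_on {0..1} (\<lambda>s. coupling G t x (\<gamma> s))"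
    proof (rule lipschitz_onI)
      show "dist (coupling G t x (\<gamma> s)) (coupling G t x (\<gamma> s')) \<le> Lf * N * dist s s'"
        if "s \<in> {0..1}" "s' \<in> {0..1}" for s s'
        using coupling_lipschitz[OF t x \<gamma>[OF that(1)] \<gamma>[OF that(2)]]
        by (simp add: dist_real_def \<gamma>N mult_ac)
      show "0 \<le> Lf * N" using Lf_pos by (simp add: N_def L2_set_nonneg)
    qed
  qed
  have int: "\<phi> integrable_on {0..1}"
    unfolding \<phi>_def by (intro integrable_continuous_interval continuous_intros cont_c)
  have Feq: "F t \<nu> - F t \<mu> = integral {0..1} \<phi>"
    using a3 t p unfolding assumption3_def \<phi>_def \<gamma>_def by blast
  have \<phi>_lower: "\<phi> 0 \<le> \<phi> s" if s: "s \<in> {0..1}" for s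
  proof (cases "s = 0")
    case False
    have "0 \<le> (\<Sum>x\<in>S. (coupling G t x (\<gamma> s) - coupling G t x \<mu>) * (\<gamma> s x - \<mu> x))"
      by (rule coupling_monotone[OF t \<gamma>[OF s] p(1)])
    also have "\<dots> = s * (\<phi> s - \<phi> 0)"
    proof -
      have "\<gamma> s x - \<mu> x = s * (\<nu> x - \<mu> x)" for x by (simp add: \<gamma>_def)
      then have "(coupling G t x (\<gamma> s) - coupling G t x \<mu>) * (\<gamma> s x - \<mu> x)
          = s * (coupling G t x (\<gamma> s) * (\<nu> x - \<mu> x) - coupling G t x (\<gamma> 0) * (\<nu> x - \<mu> x))" for x
        unfolding \<gamma>0 by (simp add: left_diff_distrib right_diff_distrib)
      then show ?thesis
        unfolding \<phi>_def by (simp add: sum_subtractf sum_distrib_left[symmetric])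
    qed
    finally show ?thesis using False s by (simp add: zero_le_mult_iff)
  qed simp
  have \<phi>_upper: "\<phi> s \<le> \<phi> 0 + s * K" if s: "s \<in> {0..1}" for s
  proof -
    have "\<phi> s - \<phi> 0 = (\<Sum>x\<in>S. (coupling G t x (\<gamma> s) - coupling G t x (\<gamma> 0)) * (\<nu> x - \<mu> x))"
      unfolding \<phi>_def by (simp add: sum_subtractf[symmetric] left_diff_distrib)
    also have "\<dots> \<le> Lf * sqrt (real (card S)) * (\<bar>s - 0\<bar> * N) * N"
      using coupling_diff_bound[OF t \<gamma>[OF s] \<gamma>[of 0], of "\<lambda>x. \<nu> x - \<mu> x"]
      by (simp only: \<gamma>N N_def[symmetric]) auto
    also have "\<dots> = s * K" using s by (simp add: K_def power2_eq_square)
    finally show ?thesis by simp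
  qed
  have "integral {0..1} (\<lambda>s::real. \<phi> 0) \<le> integral {0..1} \<phi>"
    by (intro integral_le int \<phi>_lower) auto
  then show "(\<Sum>x\<in>S. coupling G t x \<mu> * (\<nu> x - \<mu> x)) \<le> F t \<nu> - F t \<mu>"
    by (simp add: Feq \<phi>_def \<gamma>0)
  have hi: "((\<lambda>s. \<phi> 0 + s * K) has_integral ((\<phi> 0 * 1 + 1\<^sup>2 / 2 * K) - (\<phi> 0 * 0 + 0\<^sup>2 / 2 * K))) {0..1}"
    by (rule fundamental_theorem_of_calculus)
       (auto intro!: derivative_eq_intros simp: has_real_derivative_iff_has_vector_derivative[symmetric])
  have "integral {0..1} \<phi> \<le> \<phi> 0 + K / 2"
    using has_integral_le[OF integrable_integral[OF int] hi \<phi>_upper] by simp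
  then show "F t \<nu> - F t \<mu> \<le> (\<Sum>x\<in>S. coupling G t x \<mu> * (\<nu> x - \<mu> x))
      + Lf * sqrt (real (card S)) / 2 * (L2_set (\<lambda>x. \<nu> x - \<mu> x) S)\<^sup>2"
    by (simp add: Feq \<phi>_def \<gamma>0 K_def N_def)
qed

abbreviation pathnorm :: "(nat \<Rightarrow> 'a \<Rightarrow> real) \<Rightarrow> real" where
  "pathnorm \<equiv> norm_inf_2 {..T} S"

text \<open>
  A Lipschitz constant, in the Euclidean norm on \<open>\<real>\<^sup>S\<close>, of the coupling seen as a vector field on
  the probability vectors.
\<close>
definition smoothness :: real where
  "smoothness = Lf * sqrt (real (card S))"

lemma smoothness_pos: "0 < smoothness"
  using Lf_pos finite_S S_nonempty by (simp add: smoothness_def card_gt_0_iff)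

text \<open>
  The values of \<open>F\<close> at both distributions are compared with its linearisation at \<open>m t\<close>: from above
  for \<open>v\<close>, from below for \<open>v'\<close>. The linear parts turn the total costs into frozen costs, and
  averaging over time leaves the quadratic error of \<open>v\<close> alone.
\<close>
lemma total_value_diff_le:
  assumes m: "m \<in> prob_paths G" and v: "policy v" and v': "policy v'"
  shows "total_value v - total_value v' \<le> frozen_value m v - frozen_value m v'
    + smoothness / 2 * (pathnorm (\<lambda>t x. FP G v t x - m t x))\<^sup>2"
proof -
  let ?f = "\<lambda>t x. coupling G t x (m t)" and ?\<mu> = "FP G v" and ?\<nu> = "FP G v'"
  let ?R = "smoothness / 2 * (pathnorm (\<lambda>t x. FP G v t x - m t x))\<^sup>2"
  have "F t (?\<mu> t) - F t (?\<nu> t) \<le> (\<Sum>x\<in>S. ?f t x * ?\<mu> t x) - (\<Sum>x\<in>S. ?f t x * ?\<nu> t x) + ?R"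
    if t: "t < T" for t
  proof -
    have tT: "t \<le> T" using t by simp
    have pr: "m t \<in> prob_funs S" "?\<mu> t \<in> prob_funs S" "?\<nu> t \<in> prob_funs S"
      using prob_paths_prob_funs[OF _ tT] m v v' policy_FP_prob_paths by auto
    have "smoothness / 2 * (L2_set (\<lambda>x. ?\<mu> t x - m t x) S)\<^sup>2 \<le> ?R"
      using smoothness_pos L2_set_le_norm_inf_2[OF tT, of "\<lambda>t x. ?\<mu> t x - m t x" S]
      by (intro mult_left_mono power_mono L2_set_nonneg) auto
    moreover have "F t (?\<mu> t) - F t (m t) \<le> (\<Sum>x\<in>S. ?f t x * (?\<mu> t x - m t x))
        + smoothness / 2 * (L2_set (\<lambda>x. ?\<mu> t x - m t x) S)\<^sup>2"
      using potential_bounds(2)[OF t pr(1,2)] by (simp add: smoothness_def)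
    moreover have "(\<Sum>x\<in>S. ?f t x * (?\<nu> t x - m t x)) \<le> F t (?\<nu> t) - F t (m t)"
      by (rule potential_bounds(1)[OF t pr(1,3)])
    ultimately show ?thesis by (simp add: right_diff_distrib sum_subtractf)
  qed
  then have "(\<Sum>t<T. F t (?\<mu> t) - F t (?\<nu> t))
      \<le> (\<Sum>t<T. (\<Sum>x\<in>S. ?f t x * ?\<mu> t x) - (\<Sum>x\<in>S. ?f t x * ?\<nu> t x) + ?R)"
    by (intro sum_mono) auto
  also have "\<dots> = (\<Sum>t<T. \<Sum>x\<in>S. ?f t x * ?\<mu> t x) - (\<Sum>t<T. \<Sum>x\<in>S. ?f t x * ?\<nu> t x) + real T * ?R"
    by (simp add: sum.distrib sum_subtractf)
  finally have "dt * (\<Sum>t<T. F t (?\<mu> t) - F t (?\<nu> t))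
    \<le> dt * ((\<Sum>t<T. \<Sum>x\<in>S. ?f t x * ?\<mu> t x) - (\<Sum>t<T. \<Sum>x\<in>S. ?f t x * ?\<nu> t x) + real T * ?R)"
    using dt_pos by (intro mult_left_mono) auto
  also have "\<dots> = dt * (\<Sum>t<T. \<Sum>x\<in>S. ?f t x * ?\<mu> t x) - dt * (\<Sum>t<T. \<Sum>x\<in>S. ?f t x * ?\<nu> t x)
      + (real T * dt) * ?R"
    by (simp add: algebra_simps)
  finally show ?thesis
    unfolding T_dt total_value_def frozen_value_def
    by (simp add: sum_subtractf sum.distrib distrib_left distrib_right right_diff_distrib)
qed

section \<open>The constants that bound the iterates\<close>

lemma norm_FP_le_C1:
  assumes "v \<in> funs_on {..<T} S" "norm_inf_inf {..<T} S v \<le> D"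
  shows "(pathnorm (FP G v))\<^sup>2 \<le> const_C1 G D"
  unfolding const_C1_def
proof (rule cSUP_upper)
  show "bdd_above ((\<lambda>v. (pathnorm (FP G v))\<^sup>2) ` {v \<in> funs_on {..<T} S. norm_inf_inf {..<T} S v \<le> D})"
  proof (rule bdd_aboveI2)
    fix v :: "nat \<Rightarrow> 'a \<Rightarrow> 'a"
    assume "v \<in> {v \<in> funs_on {..<T} S. norm_inf_inf {..<T} S v \<le> D}"
    then have le: "norm (v t x) \<le> D" if "t < T" "x \<in> S" for t x
      using norm_inf_inf_leD that by auto
    have "pathnorm (FP G v) \<le> 1"
      by (intro norm_inf_2_leI prob_funs_L2_set_le_1 finite_S FP_prob_funs le)
    then show "(pathnorm (FP G v))\<^sup>2 \<le> 1"
      using norm_inf_2_nonneg by (intro power_le_one)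
  qed
qed (use assms in simp)

lemma best_response_le_C2:
  assumes m: "m \<in> prob_paths G" and tx: "t \<le> T" "x \<in> S"
  shows "FP G (best_response m) t x \<le> const_C2 G"
proof -
  have le1: "norm_inf_inf {..T} S (FP G (best_response m)) \<le> 1" for m
  proof -
    have "norm (FP G (best_response m) t x) \<le> 1" if "t \<le> T" for t x
      using prob_funs_le_1[OF finite_S] policy_FP_nonneg[OF best_response_policy that]
        prob_paths_prob_funs[OF policy_FP_prob_paths[OF best_response_policy] that] by auto
    then show ?thesis
      unfolding norm_inf_inf_def using finite_S S_nonempty by (auto simp: Max_le_iff)
  qed
  have "FP G (best_response m) t x \<le> (MAX x\<in>S. norm (FP G (best_response m) t x))"
  proof -
    have "norm (FP G (best_response m) t x) \<le> (MAX x\<in>S. norm (FP G (best_response m) t x))"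
      using tx finite_S by (intro Max_ge) auto
    then show ?thesis using abs_ge_self[of "FP G (best_response m) t x"] by simp
  qed
  also have "\<dots> \<le> norm_inf_inf {..T} S (FP G (best_response m))"
    unfolding norm_inf_inf_def using tx by (intro Max_ge) auto
  also have "\<dots> \<le> const_C2 G"
    unfolding const_C2_def best_response_def
    by (rule cSUP_upper[OF m]) (use le1 in \<open>auto intro!: bdd_aboveI2 simp: best_response_def\<close>)
  finally show ?thesis .
qed

lemma pathnorm_diff_sq_le:
  assumes "(pathnorm \<mu>)\<^sup>2 \<le> c" "(pathnorm \<nu>)\<^sup>2 \<le> c"
  shows "(pathnorm (\<lambda>t x. \<mu> t x - \<nu> t x))\<^sup>2 \<le> 4 * c"
proof -
  have "(pathnorm (\<lambda>t x. \<mu> t x - \<nu> t x))\<^sup>2 \<le> (pathnorm \<mu> + pathnorm \<nu>)\<^sup>2"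
    by (intro power_mono norm_inf_2_diff_le norm_inf_2_nonneg)
  also have "\<dots> \<le> 2 * (pathnorm \<mu>)\<^sup>2 + 2 * (pathnorm \<nu>)\<^sup>2"
    using sum_squares_bound[of "pathnorm \<mu>" "pathnorm \<nu>"] by (simp add: power2_sum)
  finally show ?thesis using assms by linarith
qed

section \<open>Optimality gap, duality gap and descent\<close>

text \<open>
  The Frank--Wolfe duality gap \<open>\<sigma>\<close> at the distribution of \<open>v\<close>.
\<close>
definition fw_gap :: "(nat \<Rightarrow> 'a \<Rightarrow> 'a) \<Rightarrow> real" where
  "fw_gap v = frozen_value (FP G v) v - frozen_value (FP G v) (best_response (FP G v))"

definition best_response_dist_sq :: "(nat \<Rightarrow> 'a \<Rightarrow> 'a) \<Rightarrow> real" where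
  "best_response_dist_sq v = (pathnorm (\<lambda>t x. FP G v t x - FP G (best_response (FP G v)) t x))\<^sup>2"

lemma solution_policy:
  assumes "mfg_solution G u v m"
  shows "policy v" "m = FP G v" "v = best_response (FP G v)"
proof -
  have eq: "v = best_response m" "m = FP G v" using assms unfolding mfg_solution_def best_response_def by metis+
  show "policy v" unfolding eq(1) by (rule best_response_policy)
  show "m = FP G v" by (rule eq(2))
  show "v = best_response (FP G v)" using eq(1) unfolding eq(2)[symmetric] .
qed

lemma pathnorm_zero: "pathnorm (\<lambda>t x. 0) = 0"
  using norm_inf_2_scale_le[of T S 0 "\<lambda>t x. 0"] norm_inf_2_nonneg[of T S "\<lambda>t x. 0"] by simp

text \<open>
  The linearisation at the distribution of \<open>v\<close> itself has no quadratic error, and the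
  best response minimises the frozen cost among all policies.
\<close>
lemma total_value_le_gap:
  assumes "policy v" "policy v'"
  shows "total_value v - total_value v' \<le> fw_gap v"
  using total_value_diff_le[OF policy_FP_prob_paths[OF assms(1)] assms]
    frozen_value_best_response_le[OF assms(2), of "FP G v"]
  by (simp add: fw_gap_def pathnorm_zero)

text \<open>
  The equilibrium control is its own best response, so its duality gap vanishes.
\<close>
lemma solution_minimizes:
  assumes sol: "mfg_solution G u vb mb" and v: "policy v"
  shows "total_value vb \<le> total_value v"
proof -
  note vb = solution_policy[OF sol]
  have "fw_gap vb = 0" unfolding fw_gap_def vb(3)[symmetric] by simp
  then show ?thesis using total_value_le_gap[OF vb(1) v] by simp
qed

lemma D1_eq: "const_D1 G D Lf = const_C1 G D * smoothness"
  by (simp add: const_D1_def smoothness_def)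

lemma norm_policy_le_C1: "policy v \<Longrightarrow> (pathnorm (FP G v))\<^sup>2 \<le> const_C1 G D"
  using norm_FP_le_C1 policy_norm_inf_inf by (auto simp: policy_def)

lemma D1_nonneg: "0 \<le> const_D1 G D Lf"
proof -
  have "0 \<le> const_C1 G D"
    using norm_policy_le_C1[OF best_response_policy, of undefined] zero_le_power2 by (rule order_trans[rotated])
  then show ?thesis using smoothness_pos by (simp add: D1_eq)
qed

lemma best_response_dist_sq_le: "policy v \<Longrightarrow> smoothness / 2 * best_response_dist_sq v \<le> 2 * const_D1 G D Lf"
  using mult_left_mono[OF pathnorm_diff_sq_le[OF norm_policy_le_C1 norm_policy_le_C1[OF best_response_policy]],
      of v "smoothness / 2" "FP G v"] smoothness_pos
  by (simp add: best_response_dist_sq_def D1_eq mult_ac)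

text \<open>
  The control \<open>v0\<close> may have infinite cost. The estimate linearises at \<open>m0\<close> without evaluating the
  cost there, and the frozen part of the difference is not positive because \<open>best_response m0\<close>
  is optimal for it.
\<close>
lemma first_iterate_gap:
  assumes adm: "(m0, v0) \<in> admissible G D" and v: "policy v"
  shows "total_value (best_response m0) - total_value v \<le> 2 * const_D1 G D Lf"
proof -
  have m0: "m0 \<in> prob_paths G" "m0 = FP G v0" "(pathnorm m0)\<^sup>2 \<le> const_C1 G D"
    using adm norm_FP_le_C1 by (auto simp: admissible_def)
  have "total_value (best_response m0) - total_value v
      \<le> smoothness / 2 * (pathnorm (\<lambda>t x. FP G (best_response m0) t x - m0 t x))\<^sup>2"
    using total_value_diff_le[OF m0(1) best_response_policy v, of m0] frozen_value_best_response_le[OF v, of m0] by linarith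
  also have "\<dots> \<le> smoothness / 2 * (4 * const_C1 G D)"
    using smoothness_pos
    by (intro mult_left_mono pathnorm_diff_sq_le norm_policy_le_C1 best_response_policy m0) auto
  finally show ?thesis by (simp add: D1_eq mult_ac)
qed

text \<open>
  The frozen cost is convex along the segment, and the distance to the current distribution is
  \<open>s\<close> times the distance to the best response.
\<close>
lemma mixture_descent:
  assumes v: "policy v" and s: "0 \<le> s" "s \<le> 1"
  obtains z where "policy z"
    "FP G z = (\<lambda>t x. (1 - s) * FP G v t x + s * FP G (best_response (FP G v)) t x)"
    "flux (FP G z) z = (\<lambda>t x. (1 - s) *\<^sub>R flux (FP G v) v t x
      + s *\<^sub>R flux (FP G (best_response (FP G v))) (best_response (FP G v)) t x)"
    "total_value z \<le> total_value v - s * fw_gap v + s\<^sup>2 * (smoothness / 2 * best_response_dist_sq v)"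
proof -
  let ?b = "best_response (FP G v)"
  obtain z where z: "policy z"
    "FP G z = (\<lambda>t x. (1 - s) * FP G v t x + s * FP G ?b t x)"
    "flux (FP G z) z = (\<lambda>t x. (1 - s) *\<^sub>R flux (FP G v) v t x + s *\<^sub>R flux (FP G ?b) ?b t x)"
    "\<And>t x. t < T \<Longrightarrow> x \<in> S \<Longrightarrow> real_cost t x (z t x) * FP G z t x
      \<le> (1 - s) * (real_cost t x (v t x) * FP G v t x) + s * (real_cost t x (?b t x) * FP G ?b t x)"
    using policy_mixture[OF v best_response_policy s] by blast
  have "(\<lambda>t x. FP G z t x - FP G v t x) = (\<lambda>t x. (- s) * (FP G v t x - FP G ?b t x))"
    by (simp add: z(2) fun_eq_iff algebra_simps)
  then have "pathnorm (\<lambda>t x. FP G z t x - FP G v t x)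
      \<le> s * pathnorm (\<lambda>t x. FP G v t x - FP G ?b t x)"
    using norm_inf_2_scale_le[of T S "- s" "\<lambda>t x. FP G v t x - FP G ?b t x"] s by simp
  then have "(pathnorm (\<lambda>t x. FP G z t x - FP G v t x))\<^sup>2
      \<le> (s * pathnorm (\<lambda>t x. FP G v t x - FP G ?b t x))\<^sup>2"
    by (intro power_mono norm_inf_2_nonneg)
  then have "(pathnorm (\<lambda>t x. FP G z t x - FP G v t x))\<^sup>2 \<le> s\<^sup>2 * best_response_dist_sq v"
    by (simp add: best_response_dist_sq_def power_mult_distrib)
  then have "smoothness / 2 * (pathnorm (\<lambda>t x. FP G z t x - FP G v t x))\<^sup>2
      \<le> smoothness / 2 * (s\<^sup>2 * best_response_dist_sq v)"
    using smoothness_pos by (intro mult_left_mono) auto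
  moreover have "frozen_value (FP G v) z - frozen_value (FP G v) v \<le> - (s * fw_gap v)"
    using frozen_value_mixture[OF z(2,4), where m = "FP G v"] by (simp add: fw_gap_def algebra_simps)
  ultimately have "total_value z - total_value v \<le> - (s * fw_gap v) + s\<^sup>2 * (smoothness / 2 * best_response_dist_sq v)"
    using total_value_diff_le[OF policy_FP_prob_paths[OF v] z(1) v] by (simp add: mult_ac)
  then show thesis using that[OF z(1,2,3)] by linarith
qed

text \<open>
  This error bound is where strong convexity improves the rate. The stability estimate involves
  the squared mass \<open>m\<^sup>2\<close>, the quadratic growth only \<open>m\<close>; the bound \<open>m \<le> C\<^sub>2\<close> mediates between them.
\<close>
lemma best_response_dist_sq_le_gap:
  assumes v: "policy v" and C2: "\<And>t x. t < T \<Longrightarrow> x \<in> S \<Longrightarrow> FP G v t x \<le> const_C2 G"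
    and C3: "stability_const G D C3"
  shows "best_response_dist_sq v \<le> 2 * const_C2 G * C3 / \<alpha> * fw_gap v"
proof -
  let ?b = "best_response (FP G v)" and ?C2 = "const_C2 G"
  let ?Q = "\<Sum>t<T. \<Sum>x\<in>S. FP G v t x * (norm (v t x - ?b t x))\<^sup>2"
  have C3pos: "0 < C3" using C3 by (simp add: stability_const_def)
  have "(\<Sum>t<T. \<Sum>x\<in>S. (norm (FP G v t x *\<^sub>R (v t x - ?b t x)))\<^sup>2) \<le> (\<Sum>t<T. \<Sum>x\<in>S. ?C2 * (FP G v t x * (norm (v t x - ?b t x))\<^sup>2))"
  proof (intro sum_mono)
    fix t x assume tx: "t \<in> {..<T}" "x \<in> S"
    have nn: "0 \<le> FP G v t x" using policy_FP_nonneg[OF v] tx by simp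
    have "(norm (FP G v t x *\<^sub>R (v t x - ?b t x)))\<^sup>2
        = FP G v t x * (FP G v t x * (norm (v t x - ?b t x))\<^sup>2)"
      by (simp add: power_mult_distrib power2_eq_square mult_ac)
    also have "\<dots> \<le> ?C2 * (FP G v t x * (norm (v t x - ?b t x))\<^sup>2)"
      using C2 tx nn by (intro mult_right_mono) auto
    finally show "(norm (FP G v t x *\<^sub>R (v t x - ?b t x)))\<^sup>2
      \<le> ?C2 * (FP G v t x * (norm (v t x - ?b t x))\<^sup>2)" .
  qed
  also have "\<dots> = ?C2 * ?Q" by (simp add: sum_distrib_left)
  finally have "C3 * dt * (\<Sum>t<T. \<Sum>x\<in>S. (norm (FP G v t x *\<^sub>R (v t x - ?b t x)))\<^sup>2)
      \<le> C3 * dt * (?C2 * ?Q)"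
    using C3pos dt_pos by (intro mult_left_mono) auto
  moreover have "best_response_dist_sq v \<le> C3 * dt * (\<Sum>t<T. \<Sum>x\<in>S. (norm (FP G v t x *\<^sub>R (v t x - ?b t x)))\<^sup>2)"
    using C3 policy_admissible[OF v] policy_admissible[OF best_response_policy]
    unfolding stability_const_def best_response_dist_sq_def by blast
  ultimately have "best_response_dist_sq v \<le> C3 * ?C2 * (dt * ?Q)" by (simp add: mult_ac)
  also have "\<dots> \<le> C3 * ?C2 * (2 / \<alpha> * fw_gap v)"
  proof (rule mult_left_mono)
    have "\<alpha> / 2 * (dt * ?Q) \<le> fw_gap v"
      using frozen_value_growth[OF v, of "FP G v"] by (simp add: fw_gap_def mult.assoc)
    then show "dt * ?Q \<le> 2 / \<alpha> * fw_gap v" using \<alpha>_pos by (simp add: field_simps)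
    obtain x where x: "x \<in> S" using S_nonempty by blast
    have "0 \<le> ?C2" using C2[OF T_pos x] policy_FP_nonneg[OF v, of 0 x] by simp
    then show "0 \<le> C3 * ?C2" using C3pos by simp
  qed
  finally show ?thesis by (simp add: mult_ac)
qed

lemma C2_pos:
  assumes v: "policy v" and C2: "\<And>t x. t < T \<Longrightarrow> x \<in> S \<Longrightarrow> FP G v t x \<le> const_C2 G"
  shows "0 < const_C2 G"
proof (rule ccontr)
  assume "\<not> 0 < const_C2 G"
  then have "(\<Sum>x\<in>S. FP G v 0 x) \<le> 0" using C2[OF T_pos] by (intro sum_nonpos) force
  then show False using init_prob by (simp add: prob_funs_def)
qed

lemma best_response_dist_sq_pos:
  assumes v: "policy v" and neq: "FP G v \<noteq> FP G (best_response (FP G v))"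
  shows "0 < best_response_dist_sq v"
proof -
  let ?d = "\<lambda>t x. FP G v t x - FP G (best_response (FP G v)) t x"
  obtain t x where tx: "?d t x \<noteq> 0" using neq by (auto simp: fun_eq_iff)
  then have "t \<le> T" "x \<in> S"
    using policy_FP_prob_paths[OF v] policy_FP_prob_paths[OF best_response_policy, of "FP G v"]
    by (auto simp: prob_paths_def funs_on_def) (metis diff_self)+
  moreover have "\<bar>?d t x\<bar> \<le> L2_set (\<lambda>x. \<bar>?d t x\<bar>) S"
    using member_le_L2_set[OF finite_S \<open>x \<in> S\<close>, of "\<lambda>x. \<bar>?d t x\<bar>"] by simp
  moreover have "L2_set (\<lambda>x. \<bar>?d t x\<bar>) S = L2_set (?d t) S" by (simp add: L2_set_def)
  ultimately have "0 < pathnorm ?d"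
    using L2_set_le_norm_inf_2[of t T ?d S] tx by linarith
  then show ?thesis by (simp add: best_response_dist_sq_def)
qed

section \<open>The iterates of the algorithm\<close>

text \<open>
  The invariant of the algorithm. The bound by \<^const>\<open>const_C2\<close> holds for best responses and is
  inherited by convex combinations; it starts with the first iterate, which is a best response.
\<close>
definition iterate_policy ::
  "(nat \<Rightarrow> nat \<Rightarrow> 'a \<Rightarrow> real) \<Rightarrow> (nat \<Rightarrow> nat \<Rightarrow> 'a \<Rightarrow> 'a) \<Rightarrow> nat \<Rightarrow> (nat \<Rightarrow> 'a \<Rightarrow> 'a) \<Rightarrow> bool" where
  "iterate_policy m w k v \<longleftrightarrow> policy v \<and> m k = FP G v \<and> w k = flux (FP G v) v \<and>
    (\<forall>t\<le>T. \<forall>x\<in>S. FP G v t x \<le> const_C2 G)"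

lemma iterate_first:
  assumes fw: "frank_wolfe G D lam m w" and v: "policy v"
  shows "iterate_policy m w 1 (best_response (m 0))"
    and "total_value (best_response (m 0)) - total_value v \<le> 2 * const_D1 G D Lf"
proof -
  obtain v0 where v0: "(m 0, v0) \<in> admissible G D"
    using fw by (auto simp: frank_wolfe_def admissible_flux_def)
  then have "m 0 \<in> prob_paths G" unfolding admissible_def by blast
  then show "iterate_policy m w 1 (best_response (m 0))"
    using fw best_response_policy best_response_le_C2 by (simp add: iterate_policy_def frank_wolfe_def BR_eq)
  show "total_value (best_response (m 0)) - total_value v \<le> 2 * const_D1 G D Lf"
    by (rule first_iterate_gap[OF v0 v])
qed

lemma iterate_step:
  assumes fw: "frank_wolfe G D lam m w" and k: "1 \<le> k" and v: "iterate_policy m w k v"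
  obtains z where "iterate_policy m w (Suc k) z"
    "total_value z \<le> total_value v - lam k * fw_gap v + (lam k)\<^sup>2 * (smoothness / 2 * best_response_dist_sq v)"
proof -
  have p: "policy v" and mk: "m k = FP G v" and wk: "w k = flux (FP G v) v"
    and C2: "\<And>t x. t \<le> T \<Longrightarrow> x \<in> S \<Longrightarrow> FP G v t x \<le> const_C2 G"
    using v by (auto simp: iterate_policy_def)
  have s: "0 \<le> lam k" "lam k \<le> 1" using fw k by (auto simp: frank_wolfe_def)
  obtain z where z: "policy z"
    "FP G z = (\<lambda>t x. (1 - lam k) * FP G v t x + lam k * FP G (best_response (FP G v)) t x)"
    "flux (FP G z) z = (\<lambda>t x. (1 - lam k) *\<^sub>R flux (FP G v) v t x
      + lam k *\<^sub>R flux (FP G (best_response (FP G v))) (best_response (FP G v)) t x)"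
    "total_value z \<le> total_value v - lam k * fw_gap v + (lam k)\<^sup>2 * (smoothness / 2 * best_response_dist_sq v)"
    using mixture_descent[OF p s] by blast
  have "FP G z t x \<le> const_C2 G" if "t \<le> T" "x \<in> S" for t x
  proof -
    have "FP G z t x \<le> (1 - lam k) * const_C2 G + lam k * const_C2 G"
      unfolding z(2) using s C2[OF that] best_response_le_C2[OF policy_FP_prob_paths[OF p] that]
      by (intro add_mono mult_left_mono) auto
    then show ?thesis by (simp add: algebra_simps)
  qed
  moreover have "m (Suc k) = FP G z"
    using fw k unfolding z(2) by (simp add: frank_wolfe_def BR_eq mk)
  moreover have "w (Suc k) = flux (FP G z) z"
    using fw k unfolding z(3) by (simp add: frank_wolfe_def BR_eq mk wk)
  ultimately have "iterate_policy m w (Suc k) z" using z(1) by (simp add: iterate_policy_def)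
  then show thesis using z(4) by (rule that)
qed

text \<open>
  The distance to the best response vanishes exactly when the distributions agree, because both
  are zero outside the states and the time range; so the test for equality can be replaced by
  \<open>best_response_dist_sq v = 0\<close>, and the extended-real quotient is a quotient of reals.
\<close>
lemma adaptive_step_size:
  assumes steps: "adaptive_steps G Lf lam m w" and k: "1 \<le> k" and v: "iterate_policy m w k v"
  shows "lam k = (if best_response_dist_sq v = 0 then 1 else min (fw_gap v / (smoothness * best_response_dist_sq v)) 1)"
proof -
  have p: "policy v" and mk: "m k = FP G v" and wk: "w k = flux (FP G v) v"
    using v by (auto simp: iterate_policy_def)
  let ?b = "best_response (FP G v)"
  have lam: "ereal (lam k) = (if FP G v = FP G ?b then 1
      else min ((ereal (frozen_value (FP G v) v) - ereal (frozen_value (FP G v) ?b))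
        / ereal (smoothness * best_response_dist_sq v)) 1)"
    using steps k unfolding adaptive_steps_def
    by (simp add: BR_eq mk wk frozen_cost_policy[OF p] frozen_cost_policy[OF best_response_policy]
        smoothness_def best_response_dist_sq_def)
  show ?thesis
  proof (cases "FP G v = FP G ?b")
    case True
    then have "best_response_dist_sq v = 0" using pathnorm_zero by (simp add: best_response_dist_sq_def fun_eq_iff)
    then show ?thesis using lam True by simp
  next
    case False
    have "(ereal (frozen_value (FP G v) v) - ereal (frozen_value (FP G v) ?b))
        / ereal (smoothness * best_response_dist_sq v) = ereal (fw_gap v / (smoothness * best_response_dist_sq v))"
      using smoothness_pos best_response_dist_sq_pos[OF p False] by (auto simp: fw_gap_def)
    then have "ereal (lam k) = min (ereal (fw_gap v / (smoothness * best_response_dist_sq v))) (ereal 1)"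
      using lam False by (simp only: if_False one_ereal_def)
    then show ?thesis
      using best_response_dist_sq_pos[OF p False] by (simp add: min_def split: if_splits)
  qed
qed

section \<open>Convergence rates\<close>

text \<open>
  With \<open>s = 2/(k+2)\<close> the recursion \<open>\<epsilon>' \<le> (1 - s) \<epsilon> + 2 D\<^sub>1 s\<^sup>2\<close> carries \<open>8 D\<^sub>1 / k\<close>
  to \<open>8 D\<^sub>1 (k+3) / (k+2)\<^sup>2\<close>, and \<open>(k+1) (k+3) \<le> (k+2)\<^sup>2\<close>.
\<close>
lemma sublinear_rate:
  assumes fw: "frank_wolfe G D lam m w" and lam: "\<And>k. 1 \<le> k \<Longrightarrow> lam k = 2 / (real k + 2)"
    and vb: "policy vb" and k: "1 \<le> k"
  shows "\<exists>v. iterate_policy m w k v \<and> total_value v - total_value vb \<le> 8 * const_D1 G D Lf / real k"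
  using k
proof (induction k rule: nat_induct_at_least)
  case base
  have "2 * const_D1 G D Lf \<le> 8 * const_D1 G D Lf / real 1" using D1_nonneg by simp
  then show ?case using iterate_first[OF fw vb] by (meson order_trans)
next
  case (Suc k)
  let ?D1 = "const_D1 G D Lf"
  define s where "s = 2 / (real k + 2)"
  have s: "0 \<le> s" "s \<le> 1" using Suc.hyps by (auto simp: s_def)
  obtain v where v: "iterate_policy m w k v" "total_value v - total_value vb \<le> 8 * ?D1 / real k"
    using Suc.IH by blast
  have p: "policy v" using v(1) by (simp add: iterate_policy_def)
  obtain z where z: "iterate_policy m w (Suc k) z"
    "total_value z \<le> total_value v - s * fw_gap v + s\<^sup>2 * (smoothness / 2 * best_response_dist_sq v)"
    using iterate_step[OF fw Suc.hyps v(1)] unfolding lam[OF Suc.hyps] s_def by metis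
  have "s * (total_value v - total_value vb) \<le> s * fw_gap v"
    using total_value_le_gap[OF p vb] s by (intro mult_left_mono)
  moreover have "s\<^sup>2 * (smoothness / 2 * best_response_dist_sq v) \<le> s\<^sup>2 * (2 * ?D1)"
    by (intro mult_left_mono best_response_dist_sq_le p) auto
  ultimately have "total_value z - total_value vb
      \<le> (1 - s) * (total_value v - total_value vb) + s\<^sup>2 * (2 * ?D1)"
    using z(2) by (simp add: algebra_simps)
  also have "\<dots> \<le> (1 - s) * (8 * ?D1 / real k) + s\<^sup>2 * (2 * ?D1)"
    using v(2) by (intro add_right_mono mult_left_mono) (use s in auto)
  also have "\<dots> = 8 * ?D1 * ((real k + 3) / (real k + 2)\<^sup>2)"
  proof -
    define r where "r = real k"
    have "0 < r" using Suc.hyps by (simp add: r_def)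
    then have s1: "1 - s = r / (r + 2)" by (simp add: s_def r_def field_simps)
    have "(1 - s) * (8 * ?D1 / r) = 8 * ?D1 * (1 / (r + 2))"
      using \<open>0 < r\<close> unfolding s1 by simp
    moreover have "s\<^sup>2 * (2 * ?D1) = 8 * ?D1 * (1 / (r + 2)\<^sup>2)"
      by (simp add: s_def r_def power_divide)
    moreover have "1 / (r + 2) + 1 / (r + 2)\<^sup>2 = (r + 3) / (r + 2)\<^sup>2"
    proof -
      have "1 / (r + 2) = (r + 2) / (r + 2)\<^sup>2"
        using \<open>0 < r\<close> by (simp add: power2_eq_square)
      then show ?thesis by (simp add: add_divide_distrib[symmetric])
    qed
    ultimately show ?thesis
      unfolding r_def[symmetric] by (metis distrib_left)
  qed
  also have "\<dots> \<le> 8 * ?D1 * (1 / real (Suc k))"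
  proof (rule mult_left_mono)
    show "(real k + 3) / (real k + 2)\<^sup>2 \<le> 1 / real (Suc k)"
    proof (rule mult_imp_div_pos_le)
      have "(real k + 3) * real (Suc k) \<le> (real k + 2)\<^sup>2"
        by (simp add: power2_eq_square algebra_simps)
      then show "real k + 3 \<le> 1 / real (Suc k) * (real k + 2)\<^sup>2"
        by (simp add: pos_le_divide_eq)
      show "0 < (real k + 2)\<^sup>2" by simp
    qed
  qed (use D1_nonneg in simp)
  finally show ?case using z(1) by auto
qed

text \<open>
  Each step contracts the gap by \<open>c\<close>, with \<open>K = 2 C\<^sub>2 C\<^sub>3 / \<alpha>\<close> from the error bound. The first gap
  is at most \<open>2 D\<^sub>1\<close>, and \<open>c \<ge> 1/2\<close> turns this into \<open>4 D\<^sub>1 c\<close>.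
\<close>
lemma linear_rate:
  assumes fw: "frank_wolfe G D lam m w" and steps: "adaptive_steps G Lf lam m w"
    and C3: "stability_const G D C3" and sol: "mfg_solution G u vb mb" and k: "1 \<le> k"
  shows "\<exists>v. iterate_policy m w k v \<and>
    total_value v - total_value vb \<le> 4 * const_D1 G D Lf * const_c G Lf \<alpha> C3 ^ k"
  using k
proof (induction k rule: nat_induct_at_least)
  case base
  have vb: "policy vb" using solution_policy[OF sol] by simp
  have "1 / 2 \<le> const_c G Lf \<alpha> C3" by (simp add: const_c_def)
  then have "4 * const_D1 G D Lf * (1 / 2) \<le> 4 * const_D1 G D Lf * const_c G Lf \<alpha> C3"
    using D1_nonneg by (intro mult_left_mono) auto
  then show ?case using iterate_first[OF fw vb] by (intro exI[of _ "best_response (m 0)"]) simp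
next
  case (Suc k)
  let ?c = "const_c G Lf \<alpha> C3" and ?D1 = "const_D1 G D Lf" and ?C2 = "const_C2 G"
  have vb: "policy vb" using solution_policy[OF sol] by simp
  obtain v where v: "iterate_policy m w k v" "total_value v - total_value vb \<le> 4 * ?D1 * ?c ^ k"
    using Suc.IH by blast
  have p: "policy v" and C2: "\<And>t x. t < T \<Longrightarrow> x \<in> S \<Longrightarrow> FP G v t x \<le> ?C2"
    using v(1) by (auto simp: iterate_policy_def)
  obtain z where z: "iterate_policy m w (Suc k) z"
    "total_value z \<le> total_value v - lam k * fw_gap v + (lam k)\<^sup>2 * (smoothness / 2 * best_response_dist_sq v)"
    using iterate_step[OF fw Suc.hyps v(1)] by metis
  have C3pos: "0 < C3" using C3 by (simp add: stability_const_def)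
  have K: "0 < 2 * ?C2 * C3 / \<alpha>" using C2_pos[OF p C2] C3pos \<alpha>_pos by simp
  have "total_value z - total_value vb
      \<le> max (1 - 1 / (2 * smoothness * (2 * ?C2 * C3 / \<alpha>))) (1 / 2) * (total_value v - total_value vb)"
  proof (rule adaptive_step_contraction)
    show "total_value v - total_value vb \<le> fw_gap v" by (rule total_value_le_gap[OF p vb])
    show "0 \<le> total_value v - total_value vb" using solution_minimizes[OF sol p] by simp
    show "0 \<le> best_response_dist_sq v" by (simp add: best_response_dist_sq_def)
    show "best_response_dist_sq v \<le> 2 * ?C2 * C3 / \<alpha> * fw_gap v" by (rule best_response_dist_sq_le_gap[OF p C2 C3])
    show "lam k = (if best_response_dist_sq v = 0 then 1 else min (fw_gap v / (smoothness * best_response_dist_sq v)) 1)"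
      by (rule adaptive_step_size[OF steps Suc.hyps v(1)])
    show "total_value z - total_value vb \<le> total_value v - total_value vb - lam k * fw_gap v
        + (lam k)\<^sup>2 * (smoothness / 2 * best_response_dist_sq v)"
      using z(2) by simp
  qed (use K smoothness_pos in auto)
  also have "max (1 - 1 / (2 * smoothness * (2 * ?C2 * C3 / \<alpha>))) (1 / 2) = ?c"
    by (simp add: const_c_def smoothness_def mult_ac)
  also have "?c * (total_value v - total_value vb) \<le> ?c * (4 * ?D1 * ?c ^ k)"
    using v(2) by (intro mult_left_mono) (auto simp: const_c_def le_max_iff_disj)
  finally show ?case using z(1) by (auto simp: mult_ac)
qed

end

theorem proposition3p1:
  fixes G :: "'a::euclidean_space mfg"
    and D Lf \<alpha> C3 :: real
    and F :: "nat \<Rightarrow> ('a \<Rightarrow> real) \<Rightarrow> real"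
    and ubar mbar :: "nat \<Rightarrow> 'a \<Rightarrow> real" and vbar :: "nat \<Rightarrow> 'a \<Rightarrow> 'a"
    and lam :: "nat \<Rightarrow> real"
    and m :: "nat \<Rightarrow> nat \<Rightarrow> 'a \<Rightarrow> real" and w :: "nat \<Rightarrow> nat \<Rightarrow> 'a \<Rightarrow> 'a"
  assumes "mfg_data G"
    and "assumption1 G D Lf \<alpha>"
    and "assumption2 G D"
    and "assumption3 G F"
    and "stability_const G D C3"
    and "mfg_solution G ubar vbar mbar"
    and "frank_wolfe G D lam m w"
  shows "((\<forall>k\<ge>1. lam k = 2 / (real k + 2)) \<longrightarrow>
      (\<forall>k\<ge>1. total_cost G F (m k) (w k) - total_cost G F mbar (flux mbar vbar)
        \<le> ereal (8 * const_D1 G D Lf / real k)))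
    \<and> (adaptive_steps G Lf lam m w \<longrightarrow>
      (\<forall>k\<ge>1. total_cost G F (m k) (w k) - total_cost G F mbar (flux mbar vbar)
        \<le> ereal (4 * const_D1 G D Lf * const_c G Lf \<alpha> C3 ^ k)))"
proof -
  interpret mean_field_game G D Lf \<alpha> F
    by unfold_locales (fact assms)+
  note sol = solution_policy[OF assms(6)]
  have cost: "total_cost G F (m k) (w k) - total_cost G F mbar (flux mbar vbar)
      = ereal (total_value v - total_value vbar)" if "iterate_policy m w k v" for k v
    using that total_cost_policy[OF sol(1)] total_cost_policy[of v] unfolding sol(2)
    by (simp add: iterate_policy_def)
  show ?thesis
  proof (intro conjI impI allI)
    fix k :: nat assume "\<forall>k\<ge>1. lam k = 2 / (real k + 2)" "1 \<le> k"
    then show "total_cost G F (m k) (w k) - total_cost G F mbar (flux mbar vbar)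
        \<le> ereal (8 * const_D1 G D Lf / real k)"
      using sublinear_rate[OF assms(7) _ sol(1)] cost by (metis ereal_less_eq(3))
  next
    fix k :: nat assume "adaptive_steps G Lf lam m w" "1 \<le> k"
    then show "total_cost G F (m k) (w k) - total_cost G F mbar (flux mbar vbar)
        \<le> ereal (4 * const_D1 G D Lf * const_c G Lf \<alpha> C3 ^ k)"
      using linear_rate[OF assms(7) _ assms(5,6)] cost by (metis ereal_less_eq(3))
  qed
qed

end
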